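(* Let $u$ be the mild solution of the one-dimensional stochastic wave equation with zero initial conditions driven by space-time white noise $W$. Let $\alpha$ be a fixed real number and let $M=M(N)$ be positive integers with $M(N)\to\infty$ as $N\to\infty$ and $2M^{1-\alpha}<N^{-1}$. Put $x_i=\frac iN$ for $0\le i\le N$, $t_j=jM^{-\alpha}$ for $0\le j\le M$, $$\Delta_{(ij)}=u(t_{j+1},x_{i+1})-u(t_j,x_{i+1})-u(t_{j+1},x_i)+u(t_j,x_i),$$ $$\mathcal V_{MN}=\frac1{NM}\sum_{i=0}^{N-1}\sum_{j=0}^{M-1}\left(\Delta_{(ij)}^2-\mathbb E[\Delta_{(ij)}^2]\right),\qquad \mathcal F_{MN}=\sqrt{8N}\,M^{2\alpha-1/2}\,\mathcal V_{MN}.$$ Then $$d(\mathcal F_{MN},N(0,1))\lesssim\frac{1}{\sqrt{NM}},$$ where $d$ is either the Kolmogorov, the Wasserstein or the total variation distance.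
   Context: The equation is $\partial_t^2u=\partial_x^2u+\dot W$ for $t\ge0$, $x\in\mathbb R$, with $u(0,x)=0$ and $\partial_tu(0,x)=0$. Here $W$ is space-time white noise: Wiener integrals of $f,g\in L^2([0,\infty)\times\mathbb R)$ are jointly centred Gaussian with $\mathbb E[\int f\,dW\int g\,dW]=\int_0^\infty\int_{\mathbb R}f(r,y)g(r,y)\,dy\,dr$. The mild solution is the centred Gaussian field $u(t,x)=\int_0^t\int_{\mathbb R}G_1(t-r,x-y)\,W(dr,dy)$ with $G_1(t,x)=\frac12\mathbf 1_{\{|x|<t\}}$. Distances between a random variable and $N(0,1)$ are distances between their laws. The symbol $\lesssim$ means that the ratio of the left side to the right side is bounded by a constant asymptotically, as $N\to\infty$. The condition $2M^{1-\alpha}<N^{-1}$ says that the time grid mesh $\delta_M=M^{-\alpha}$ and the space grid mesh $\Delta_N=N^{-1}$ satisfy $2\delta_MM<\Delta_N$. The variable $\mathcal F_{MN}$ is intended as the normalised version of $\mathcal V_{MN}$.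
   Formalization: As printed, F_MN has variance tending to 8, so its limit is N(0,8), not N(0,1); the formal theorem bounds the distance for V_MN divided by its exact standard deviation, and adds that Var(sqrt(N) M^{2α-1/2} V_MN) tends to 1. *)

theory Defs
  imports "HOL-Probability.Probability"
begin

section \<open>Space-time white noise\<close>

definition time_space :: "(real \<times> real) measure" where
  "time_space = restrict_space lborel ({0..} \<times> UNIV)"

definition L2_time_space :: "(real \<times> real \<Rightarrow> real) set" where
  "L2_time_space =
     {f \<in> borel_measurable time_space. integrable time_space (\<lambda>p. (f p)\<^sup>2)}"

text \<open>The first alternative is the degenerate normal law with variance zero.\<close>

definition centred_gaussian :: "'a measure \<Rightarrow> ('a \<Rightarrow> real) \<Rightarrow> bool" where
  "centred_gaussian P X \<longleftrightarrow>
     X \<in> borel_measurable P \<and>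
     ((AE \<omega> in P. X \<omega> = 0) \<or>
      (\<exists>\<sigma>>0. distributed P lborel X (\<lambda>x. ennreal (normal_density 0 \<sigma> x))))"

definition jointly_centred_gaussian ::
    "'a measure \<Rightarrow> 'i set \<Rightarrow> ('i \<Rightarrow> 'a \<Rightarrow> real) \<Rightarrow> bool" where
  "jointly_centred_gaussian P I X \<longleftrightarrow>
     (\<forall>J c. finite J \<and> J \<subseteq> I \<longrightarrow> centred_gaussian P (\<lambda>\<omega>. \<Sum>i\<in>J. c i * X i \<omega>))"

text \<open>\<open>W f\<close> is the Wiener integral of \<open>f\<close>. Linearity in \<open>f\<close> and independence of the
  representative of \<open>f\<close>, both almost surely, follow from the covariance identity.\<close>

definition space_time_white_noise ::
    "'a measure \<Rightarrow> ((real \<times> real \<Rightarrow> real) \<Rightarrow> 'a \<Rightarrow> real) \<Rightarrow> bool" where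
  "space_time_white_noise P W \<longleftrightarrow>
     prob_space P \<and>
     jointly_centred_gaussian P L2_time_space W \<and>
     (\<forall>f\<in>L2_time_space. \<forall>g\<in>L2_time_space.
        prob_space.expectation P (\<lambda>\<omega>. W f \<omega> * W g \<omega>) = (LINT p|time_space. f p * g p))"


section \<open>The mild solution of the wave equation\<close>

definition G1 :: "real \<Rightarrow> real \<Rightarrow> real" where
  "G1 t x = (if \<bar>x\<bar> < t then 1 / 2 else 0)"

definition mild_solution ::
    "((real \<times> real \<Rightarrow> real) \<Rightarrow> 'a \<Rightarrow> real) \<Rightarrow> real \<Rightarrow> real \<Rightarrow> 'a \<Rightarrow> real" where
  "mild_solution W t x = W (\<lambda>(r, y). indicator {0..t} r * G1 (t - r) (x - y))"


section \<open>Quadratic variation over a grid\<close>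

definition grid_x :: "nat \<Rightarrow> nat \<Rightarrow> real" where
  "grid_x N i = real i / real N"

definition grid_t :: "real \<Rightarrow> nat \<Rightarrow> nat \<Rightarrow> real" where
  "grid_t \<alpha> M j = real j * real M powr (- \<alpha>)"

definition rect_increment ::
    "(real \<Rightarrow> real \<Rightarrow> 'a \<Rightarrow> real) \<Rightarrow> real \<Rightarrow> nat \<Rightarrow> nat \<Rightarrow> nat \<Rightarrow> nat \<Rightarrow> 'a \<Rightarrow> real" where
  "rect_increment u \<alpha> N M i j \<omega> =
     u (grid_t \<alpha> M (j + 1)) (grid_x N (i + 1)) \<omega> - u (grid_t \<alpha> M j) (grid_x N (i + 1)) \<omega>
     - u (grid_t \<alpha> M (j + 1)) (grid_x N i) \<omega> + u (grid_t \<alpha> M j) (grid_x N i) \<omega>"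

definition quad_var ::
    "'a measure \<Rightarrow> (real \<Rightarrow> real \<Rightarrow> 'a \<Rightarrow> real) \<Rightarrow> real \<Rightarrow> nat \<Rightarrow> nat \<Rightarrow> 'a \<Rightarrow> real" where
  "quad_var P u \<alpha> N M \<omega> =
     1 / (real N * real M) *
     (\<Sum>i<N. \<Sum>j<M. (rect_increment u \<alpha> N M i j \<omega>)\<^sup>2
        - prob_space.expectation P (\<lambda>\<omega>'. (rect_increment u \<alpha> N M i j \<omega>')\<^sup>2))"

text \<open>The deterministic scale \<open>sqrt N * M powr (2 * \<alpha> - 1 / 2)\<close> normalises the quadratic
  variation only asymptotically: for \<open>2 * M powr (1 - \<alpha>) < 1 / N\<close> the variance of the scaled
  variable is \<open>(1 - 1 / (4 * M\<^sup>2)) * (1 - 1 / (3 * N))\<close>. As \<open>M\<close> and \<open>N\<close> are not otherwise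
  related, the deviation of this from 1 need not be of order \<open>1 / sqrt (N * M)\<close>, so the
  normalised variable uses the exact standard deviation.\<close>

definition scaled_quad_var ::
    "'a measure \<Rightarrow> (real \<Rightarrow> real \<Rightarrow> 'a \<Rightarrow> real) \<Rightarrow> real \<Rightarrow> nat \<Rightarrow> nat \<Rightarrow> 'a \<Rightarrow> real" where
  "scaled_quad_var P u \<alpha> N M \<omega> =
     sqrt (real N) * real M powr (2 * \<alpha> - 1 / 2) * quad_var P u \<alpha> N M \<omega>"

definition normalised_quad_var ::
    "'a measure \<Rightarrow> (real \<Rightarrow> real \<Rightarrow> 'a \<Rightarrow> real) \<Rightarrow> real \<Rightarrow> nat \<Rightarrow> nat \<Rightarrow> 'a \<Rightarrow> real" where
  "normalised_quad_var P u \<alpha> N M \<omega> =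
     quad_var P u \<alpha> N M \<omega> / sqrt (prob_space.variance P (quad_var P u \<alpha> N M))"


section \<open>Distances between laws on the real line\<close>

definition kolmogorov_dist :: "real measure \<Rightarrow> real measure \<Rightarrow> ennreal" where
  "kolmogorov_dist \<mu> \<nu> = (SUP z. ennreal \<bar>measure \<mu> {..z} - measure \<nu> {..z}\<bar>)"

definition total_variation_dist :: "real measure \<Rightarrow> real measure \<Rightarrow> ennreal" where
  "total_variation_dist \<mu> \<nu> = (SUP A\<in>sets borel. ennreal \<bar>measure \<mu> A - measure \<nu> A\<bar>)"

text \<open>Meaningful for laws with finite first moment, where every Lipschitz function is
  integrable.\<close>

definition wasserstein_dist :: "real measure \<Rightarrow> real measure \<Rightarrow> ennreal" where
  "wasserstein_dist \<mu> \<nu> =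
     (SUP h\<in>{h. 1-lipschitz_on UNIV h}. ennreal \<bar>(LINT x|\<mu>. h x) - (LINT x|\<nu>. h x)\<bar>)"

end

theory Submission
  imports Defs
begin

text \<open>The mesh condition keeps the backward light cones of different grid points in space disjoint,
  while the cones of one space point are nested in time. Hence the time increments of \<open>u\<close> at the
  grid points are independent Gaussians and \<open>\<Delta>\<close> is their difference in space, so the quadratic
  variation is a quadratic form whose matrix is a discrete Laplacian tensored with a diagonal
  matrix. The discrete sine transform diagonalises it: up to centring, the quadratic variation is
  \<open>\<Sum>a\<^sub>p (\<zeta>\<^sub>p\<^sup>2 - 1)\<close> with independent standard normal \<open>\<zeta>\<^sub>p\<close> and explicit weights. Stein's equation
  \<open>f' x - x * f x = h x - E h\<close> and Gaussian integration by parts in each \<open>\<zeta>\<^sub>p\<close> bound the distance to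
  the normal law by a multiple of \<open>sqrt (\<Sum>a\<^sub>p ^ 4)\<close> when \<open>2 * \<Sum>a\<^sub>p\<^sup>2 = 1\<close>, which is of order
  \<open>1 / sqrt (N * M)\<close>.\<close>

section \<open>Stein's equation\<close>

text \<open>Neighbouring rectangles share a time increment, so the squared increments are correlated
  in space and a limit theorem for independent summands does not apply to them directly; hence the
  diagonalisation. The weights then factor into a space eigenvalue and a time variance. With mesh d,
  the sum of their squares is at least of order N M^3 d^4 / (N M)^2 and the sum of their fourth
  powers at most of order N M^5 d^8 / (N M)^4. In the quotient of the latter by the square of the
  former d cancels and 1 / (N M) remains, so \<open>\<alpha>\<close> does not enter the constant.
  The error term in Stein's identity is again a second chaos variable with explicit weights, so its
  second moment is computed exactly. The estimate uses nothing about the solution of Stein's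
  equation but a bound on a continuous derivative, available with one constant for bounded and for
  Lipschitz test functions. Since continuity of the derivative forces continuous test functions,
  total variation is reached afterwards through inner regularity.\<close>

abbreviation (input) phi :: "real \<Rightarrow> real" where "phi \<equiv> std_normal_density"

lemma phi_pos: "0 < phi x"
  by (simp add: normal_density_pos)

lemma has_real_derivative_phi [derivative_intros]:
  "(f has_real_derivative f') (at x within S) \<Longrightarrow>
    ((\<lambda>x. phi (f x)) has_real_derivative (- f x * phi (f x) * f')) (at x within S)"
  unfolding std_normal_density_def
  by (auto intro!: derivative_eq_intros simp: field_simps)

lemma continuous_on_phi [continuous_intros]:
  "continuous_on S f \<Longrightarrow> continuous_on S (\<lambda>x. phi (f x))"
  unfolding std_normal_density_def by (auto intro!: continuous_intros)

text \<open>Expanding \<open>(x - 1)\<^sup>2 \<ge> 0\<close> dominates the Gaussian by a multiple of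
  \<open>exp (- x)\<close>, which beats every power.\<close>

lemma tendsto_power_phi_at_top: "((\<lambda>x. x ^ k * phi x) \<longlongrightarrow> 0) at_top"
proof -
  have "((\<lambda>x::real. x ^ k * exp (- x\<^sup>2 / 2)) \<longlongrightarrow> 0) at_top"
  proof (rule tendsto_sandwich[where f = "\<lambda>_. 0" and h = "\<lambda>x. exp 2 * (x ^ k / exp x)"])
    have "((\<lambda>x::real. x ^ k / exp x) \<longlongrightarrow> 0) at_top" by (rule tendsto_power_div_exp_0)
    then show "((\<lambda>x::real. exp 2 * (x ^ k / exp x)) \<longlongrightarrow> 0) at_top"
      by (rule tendsto_mult_right_zero)
    have ge: "- x\<^sup>2 / 2 \<le> 2 - x" for x :: real
      using zero_le_power2[of "x - 1"] by (simp add: power2_diff)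
    show "\<forall>\<^sub>F x::real in at_top. x ^ k * exp (- x\<^sup>2 / 2) \<le> exp 2 * (x ^ k / exp x)"
      using eventually_ge_at_top[of 0]
    proof eventually_elim
      case (elim x)
      have "x ^ k * exp (- x\<^sup>2 / 2) \<le> x ^ k * exp (2 - x)"
        using elim ge[of x] by (intro mult_left_mono) auto
      then show ?case by (simp add: exp_diff mult_ac)
    qed
    show "\<forall>\<^sub>F x::real in at_top. 0 \<le> x ^ k * exp (- x\<^sup>2 / 2)"
      using eventually_ge_at_top[of 0] by eventually_elim simp
  qed simp
  then have "((\<lambda>x::real. (1 / sqrt (2 * pi)) * (x ^ k * exp (- x\<^sup>2 / 2))) \<longlongrightarrow> 0) at_top"
    by (rule tendsto_mult_right_zero)
  then show ?thesis by (simp add: std_normal_density_def)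
qed

lemma phi_minus [simp]: "phi (- x) = phi x"
  by (simp add: std_normal_density_def)

lemma tendsto_power_phi_at_bot: "((\<lambda>x. x ^ k * phi x) \<longlongrightarrow> 0) at_bot"
proof -
  have "((\<lambda>x. (- 1) ^ k * (x ^ k * phi x)) \<longlongrightarrow> 0) at_top"
    by (intro tendsto_mult_right_zero tendsto_power_phi_at_top)
  moreover have "(- x) ^ k * phi (- x) = (- 1) ^ k * (x ^ k * phi x)" for x
    by (simp add: power_minus[of x] del: mult_minus_left)
  ultimately show ?thesis
    by (simp only: filterlim_at_bot_mirror)
qed

lemma integrable_imp_set_integrable:
  fixes f :: "'a \<Rightarrow> 'b::{banach, second_countable_topology}"
  assumes "integrable M f" "S \<in> sets M"
  shows "set_integrable M S f"
  unfolding set_integrable_def using assms(2,1) by (rule integrable_mult_indicator)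

section \<open>Calculus on half-lines and Gaussian integrability\<close>

lemma set_integral_Iic_FTC:
  fixes f F :: "real \<Rightarrow> real"
  assumes "\<And>y. (F has_real_derivative f y) (at y)" "continuous_on UNIV f"
    and "integrable lborel f" "(F \<longlongrightarrow> 0) at_bot"
  shows "(LINT y:{..x}|lborel. f y) = F x"
proof -
  have "(LBINT y=-\<infinity>..x. f y) = F x - 0"
  proof (rule interval_integral_FTC_integrable)
    show "set_integrable lborel (einterval (- \<infinity>) (ereal x)) f"
      by (rule integrable_imp_set_integrable[OF assms(3)]) simp
    show "((F \<circ> real_of_ereal) \<longlongrightarrow> 0) (at_right (- \<infinity>))"
      using assms(4) by (simp add: ereal_tendsto_simps)
    have "isCont F x" by (rule DERIV_isCont[OF assms(1)])
    then have "(F \<longlongrightarrow> F x) (at_left x)" by (simp add: isCont_def filterlim_at_split)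
    then show "((F \<circ> real_of_ereal) \<longlongrightarrow> F x) (at_left (ereal x))"
      by (simp add: ereal_tendsto_simps)
  qed (use assms in \<open>auto simp: has_real_derivative_iff_has_vector_derivative continuous_on_eq_continuous_at\<close>)
  moreover have "(LBINT y=-\<infinity>..x. f y) = (LINT y:{..<x}|lborel. f y)"
    by (simp add: interval_lebesgue_integral_def einterval_def lessThan_def)
  \<comment> \<open>The interval integral lives on the open half-line; the endpoint is a null
    set.\<close>
  moreover have "(LINT y:{..<x}|lborel. f y) = (LINT y:{..x}|lborel. f y)"
    unfolding set_lebesgue_integral_def
    by (rule integral_cong_AE)
       (use assms(3) AE_lborel_singleton[of x] in \<open>auto split: split_indicator elim!: eventually_mono\<close>)
  ultimately show ?thesis by simp
qed

lemma integral_UNIV_FTC: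
  fixes f F :: "real \<Rightarrow> real"
  assumes "\<And>y. (F has_real_derivative f y) (at y)" "continuous_on UNIV f"
    and "integrable lborel f" "(F \<longlongrightarrow> 0) at_bot" "(F \<longlongrightarrow> 0) at_top"
  shows "(LINT y|lborel. f y) = 0"
proof -
  have "(LBINT y=-\<infinity>..\<infinity>. f y) = 0 - 0"
    by (rule interval_integral_FTC_integrable)
      (use assms in \<open>auto simp: has_real_derivative_iff_has_vector_derivative
        continuous_on_eq_continuous_at ereal_tendsto_simps set_integrable_def einterval_def\<close>)
  then show ?thesis
    by (simp add: interval_lebesgue_integral_def einterval_def set_lebesgue_integral_def)
qed

text \<open>Near \<open>x\<close> the integral splits at \<open>x - 1\<close> into a constant and an
  integral over a compact interval, where the usual theorem applies.\<close>

lemma set_integral_Iic_has_real_derivative: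
  fixes g :: "real \<Rightarrow> real"
  assumes int: "integrable lborel g" and cont: "continuous_on UNIV g"
  shows "((\<lambda>x. LINT y:{..x}|lborel. g y) has_real_derivative g x) (at x)"
proof -
  let ?a = "x - 1" and ?b = "x + 1"
  have "((\<lambda>u. integral {?a..u} g) has_real_derivative g x) (at x within {?a..?b})"
    by (rule integral_has_real_derivative) (auto intro: continuous_on_subset[OF cont])
  then have "((\<lambda>u. integral {?a..u} g) has_real_derivative g x) (at x)"
    by (simp add: at_within_Icc_at)
  then have der: "((\<lambda>u. (LINT y:{..<?a}|lborel. g y) + integral {?a..u} g) has_real_derivative g x) (at x)"
    by (auto intro!: derivative_eq_intros)
  have sint: "set_integrable lborel S g" if "S \<in> sets borel" for S
    using that by (intro integrable_imp_set_integrable int) simp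
  have eq: "(LINT y:{..<?a}|lborel. g y) + integral {?a..u} g = (LINT y:{..u}|lborel. g y)"
    if "u \<in> {?a<..<?b}" for u
  proof -
    have "{..u} = {..<?a} \<union> {?a..u}" using that by auto
    moreover have "(LINT y:({..<?a} \<union> {?a..u})|lborel. g y)
        = (LINT y:{..<?a}|lborel. g y) + (LINT y:{?a..u}|lborel. g y)"
      by (rule set_integral_Un) (auto intro: sint)
    ultimately show ?thesis
      using set_borel_integral_eq_integral(2)[OF sint[of "{?a..u}"]] by simp
  qed
  show ?thesis
    by (rule has_field_derivative_transform_within_open[OF der _ _ eq, where S = "{?a<..<?b}"]) auto
qed

lemma integrable_power_phi: "integrable lborel (\<lambda>x. x ^ k * phi x)"
  using integrable_std_normal_moment[of k] by (simp add: mult.commute)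

lemma integrable_phi_bound:
  fixes h :: "real \<Rightarrow> real"
  assumes [measurable]: "h \<in> borel_measurable borel" and "\<And>x. \<bar>h x\<bar> \<le> B * (1 + x ^ (2 * k))"
  shows "integrable lborel (\<lambda>x. h x * phi x)"
proof (rule Bochner_Integration.integrable_bound)
  show "integrable lborel (\<lambda>x. B * (x ^ 0 * phi x + x ^ (2 * k) * phi x))"
    by (intro integrable_mult_right Bochner_Integration.integrable_add integrable_power_phi)
  have "\<bar>h x\<bar> * phi x \<le> B * (1 + x ^ (2 * k)) * phi x" for x
    using assms(2)[of x] by (intro mult_right_mono) auto
  also have "B * (1 + x ^ (2 * k)) * phi x \<le> \<bar>B * (phi x + x ^ (2 * k) * phi x)\<bar>" for x
    by (simp add: algebra_simps)
  finally show "AE x in lborel. norm (h x * phi x) \<le> norm (B * (x ^ 0 * phi x + x ^ (2 * k) * phi x))"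
    by (simp add: abs_mult)
qed simp

lemma integral_phi: "(LINT y|lborel. phi y) = 1"
  using integral_std_normal_moment_even[of 0] by simp

section \<open>Gaussian tails and the Mills ratio\<close>

definition Phi :: "real \<Rightarrow> real" where "Phi x = (LINT y:{..x}|lborel. phi y)"

lemma set_integrable_power_phi: "S \<in> sets borel \<Longrightarrow> set_integrable lborel S (\<lambda>x. x ^ k * phi x)"
  by (rule integrable_imp_set_integrable[OF integrable_power_phi]) simp

lemma set_integrable_phi: "S \<in> sets borel \<Longrightarrow> set_integrable lborel S phi"
  using set_integrable_power_phi[of S 0] by simp

lemma first_moment_Iic_phi: "(LINT y:{..x}|lborel. y * phi y) = - phi x"
proof -
  have "(LINT y:{..x}|lborel. - (y * phi y)) = phi x"
  proof (rule set_integral_Iic_FTC)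
    show "(phi has_real_derivative - (y * phi y)) (at y)" for y
      by (auto intro!: derivative_eq_intros)
    show "integrable lborel (\<lambda>y. - (y * phi y))"
      using integrable_power_phi[of 1] by simp
    show "(phi \<longlongrightarrow> 0) at_bot"
      using tendsto_power_phi_at_bot[of 0] by simp
  qed (intro continuous_intros)
  then show ?thesis by (simp add: set_lebesgue_integral_def)
qed

text \<open>On the half-line \<open>y \<le> x\<close>, so the first moment of the tail, which is
  \<open>- phi x\<close>, is at most \<open>x * Phi x\<close>.\<close>

lemma Phi_Mills_upper: "- x * Phi x \<le> phi x"
proof -
  have "(LINT y:{..x}|lborel. y * phi y) \<le> (LINT y:{..x}|lborel. x * phi y)"
    using set_integrable_power_phi[of "{..x}" 1] set_integrable_phi[of "{..x}"]
    by (intro set_integral_mono) (auto intro!: mult_right_mono)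
  then show ?thesis
    by (simp add: first_moment_Iic_phi Phi_def)
qed

text \<open>The left side is an antiderivative of
  \<open>(1 - 2 / (1 + y\<^sup>2)\<^sup>2) * phi y\<close>, which lies below \<open>phi y\<close>
  and tends to 0 at minus infinity when integrated.\<close>

lemma Phi_Mills_lower: "- x / (1 + x\<^sup>2) * phi x \<le> Phi x"
proof -
  have pos: "0 < 1 + y\<^sup>2" for y :: real by (simp add: add_pos_nonneg)
  have ne: "1 + y\<^sup>2 \<noteq> 0" for y :: real using pos[of y] by simp
  let ?g = "\<lambda>y::real. (1 - 2 / (1 + y\<^sup>2)\<^sup>2) * phi y"
  have sq: "1 \<le> (1 + y\<^sup>2)\<^sup>2" for y :: real
    by (rule one_le_power) simp
  have int: "integrable lborel ?g"
  proof (rule integrable_phi_bound[of _ 1 0])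
    show "\<bar>1 - 2 / (1 + y\<^sup>2)\<^sup>2\<bar> \<le> 1 * (1 + y ^ (2 * 0))" for y :: real
    proof -
      have "2 / (1 + y\<^sup>2)\<^sup>2 \<le> 2" "0 \<le> 2 / (1 + y\<^sup>2)\<^sup>2"
        using sq[of y] by (auto simp: divide_le_eq)
      then have "\<bar>1 - 2 / (1 + y\<^sup>2)\<^sup>2\<bar> \<le> 2" by (intro abs_leI) linarith+
      then show ?thesis by simp
    qed
  qed simp
  have "(LINT y:{..x}|lborel. ?g y) = - x / (1 + x\<^sup>2) * phi x"
  proof (rule set_integral_Iic_FTC)
    show "((\<lambda>x. - x / (1 + x\<^sup>2) * phi x) has_real_derivative ?g y) (at y)" for y
      by (rule derivative_eq_intros refl | simp add: ne)+
         (simp add: ne ne[unfolded power2_eq_square] power2_eq_square divide_simps, simp add: algebra_simps)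
    show "continuous_on UNIV ?g"
      by (intro continuous_intros) (simp add: ne)
    have "\<bar>x\<bar> \<le> 1 + x\<^sup>2" for x :: real
      using zero_le_power2[of "x - 1"] zero_le_power2[of "x + 1"] zero_le_power2[of x]
      by (simp add: power2_diff power2_sum abs_le_iff)
    then have le: "norm (- x / (1 + x\<^sup>2) * phi x) \<le> phi x" for x :: real
      using pos[of x] mult_right_mono[of "\<bar>x\<bar>" "1 + x\<^sup>2" "phi x"]
      by (simp add: abs_mult divide_le_eq mult_ac)
    show "((\<lambda>x. - x / (1 + x\<^sup>2) * phi x) \<longlongrightarrow> 0) at_bot"
    proof (rule Lim_null_comparison[of _ phi])
      show "\<forall>\<^sub>F x in at_bot. norm (- x / (1 + x\<^sup>2) * phi x) \<le> phi x"
        by (intro always_eventually allI le)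
      show "(phi \<longlongrightarrow> 0) at_bot"
        using tendsto_power_phi_at_bot[of 0] by simp
    qed
  qed (rule int)
  moreover have "(LINT y:{..x}|lborel. ?g y) \<le> (LINT y:{..x}|lborel. phi y)"
  proof (intro set_integral_mono integrable_imp_set_integrable[OF int] set_integrable_phi)
    show "?g y \<le> phi y" for y
      using mult_right_mono[of "1 - 2 / (1 + y\<^sup>2)\<^sup>2" 1 "phi y"] by simp
  qed auto
  ultimately show ?thesis by (simp add: Phi_def)
qed

text \<open>The left side is the integral of \<open>(x - y) * phi y\<close> over
  \<open>y \<le> x\<close>, the quantity that controls Lipschitz test functions. The extra factor
  \<open>1 / (1 + x\<^sup>2)\<close> over \<open>phi x\<close> later absorbs a factor growing
  linearly in \<open>x\<close>.\<close>

lemma Phi_Mills_defect: "x \<le> 0 \<Longrightarrow> phi x + x * Phi x \<le> phi x / (1 + x\<^sup>2)"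
proof -
  assume "x \<le> 0"
  then have "- x * (- x / (1 + x\<^sup>2) * phi x) \<le> - x * Phi x"
    by (intro mult_left_mono Phi_Mills_lower) simp
  then have "x\<^sup>2 * (phi x / (1 + x\<^sup>2)) \<le> - (x * Phi x)"
    by (simp add: power2_eq_square)
  moreover have "1 + x\<^sup>2 \<noteq> 0" by (metis add_pos_nonneg less_irrefl zero_le_power2 zero_less_one)
  then have "phi x = (1 + x\<^sup>2) * (phi x / (1 + x\<^sup>2))" by simp
  then have "phi x = phi x / (1 + x\<^sup>2) + x\<^sup>2 * (phi x / (1 + x\<^sup>2))"
    by (simp only: distrib_right mult_1)
  ultimately show ?thesis by linarith
qed

section \<open>The solution of Stein's equation and its derivative\<close>

text \<open>Divided by \<open>phi\<close> this is the solution of Stein's equation. Without the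
  division the bounds are comparisons of Gaussian integrals.\<close>

definition stein_kernel :: "(real \<Rightarrow> real) \<Rightarrow> real \<Rightarrow> real \<Rightarrow> real" where
  "stein_kernel h m x = (LINT y:{..x}|lborel. (h y - m) * phi y)"

text \<open>The quantity bounded is the derivative of the solution times \<open>phi x\<close>. The
  alternatives serve total variation and Wasserstein. For \<open>x \<le> 0\<close> the kernel is an
  integral over a tail, so Mills bounds apply: the bounded case gives 2, the Lipschitz case the
  maximum of a rational function that is at most 3.\<close>

lemma stein_derivative_bound_neg:
  assumes int: "integrable lborel (\<lambda>y. (h y - m) * phi y)"
    and h: "(\<forall>y. \<bar>h y - m\<bar> \<le> 1) \<or> (\<forall>y z. \<bar>h y - h z\<bar> \<le> \<bar>y - z\<bar>) \<and> (\<forall>y. \<bar>h y - m\<bar> \<le> \<bar>y\<bar> + 1)"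
    and x: "x \<le> 0"
  shows "\<bar>x * stein_kernel h m x + (h x - m) * phi x\<bar> \<le> 3 * phi x"
  using h
proof
  assume bd: "\<forall>y. \<bar>h y - m\<bar> \<le> 1"
  have "\<bar>stein_kernel h m x\<bar> \<le> (LINT y:{..x}|lborel. \<bar>(h y - m) * phi y\<bar>)"
    using integral_norm_bound[of lborel "\<lambda>y. indicator {..x} y *\<^sub>R ((h y - m) * phi y)"]
    by (simp add: stein_kernel_def set_lebesgue_integral_def abs_mult)
  also have "\<dots> \<le> Phi x"
    unfolding Phi_def
    by (intro set_integral_mono integrable_imp_set_integrable integrable_abs int set_integrable_phi)
       (use bd in \<open>auto simp: abs_mult intro!: mult_left_le_one_le\<close>)
  finally have "- x * \<bar>stein_kernel h m x\<bar> \<le> - x * Phi x"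
    using x by (intro mult_left_mono) auto
  then have "\<bar>x * stein_kernel h m x\<bar> \<le> phi x"
    using Phi_Mills_upper[of x] x by (simp add: abs_mult)
  moreover have "\<bar>(h x - m) * phi x\<bar> \<le> 1 * phi x"
    using mult_right_mono[of "\<bar>h x - m\<bar>" 1 "phi x"] bd by (simp add: abs_mult)
  ultimately show ?thesis using phi_pos[of x] by linarith
next
  assume "(\<forall>y z. \<bar>h y - h z\<bar> \<le> \<bar>y - z\<bar>) \<and> (\<forall>y. \<bar>h y - m\<bar> \<le> \<bar>y\<bar> + 1)"
  then have lip: "\<bar>h y - h z\<bar> \<le> \<bar>y - z\<bar>" and gr: "\<bar>h y - m\<bar> \<le> \<bar>y\<bar> + 1" for y z by auto
  \<comment> \<open>Comparing \<open>h y\<close> with \<open>h x\<close> instead of \<open>m\<close>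
    makes the leading terms cancel: the expression becomes \<open>x * D + (h x - m) * E\<close>,
    with both \<open>D\<close> and \<open>E\<close> as small as the Mills defect.\<close>
  define D where "D = (LINT y:{..x}|lborel. (h y - h x) * phi y)"
  define E where "E = phi x + x * Phi x"
  have intD: "integrable lborel (\<lambda>y. (h y - h x) * phi y)"
  proof -
    have "integrable lborel (\<lambda>y. (h y - m) * phi y + (m - h x) * (y ^ 0 * phi y))"
      by (intro Bochner_Integration.integrable_add int integrable_mult_right integrable_power_phi)
    then show ?thesis by (simp add: algebra_simps)
  qed
  have split: "stein_kernel h m x = D + (h x - m) * Phi x"
  proof -
    have "stein_kernel h m x = (LINT y:{..x}|lborel. (h y - h x) * phi y + (h x - m) * phi y)"
      unfolding stein_kernel_def by (simp add: algebra_simps)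
    also have "\<dots> = D + (h x - m) * Phi x"
      unfolding D_def Phi_def
      by (subst set_integral_add) (auto intro!: integrable_imp_set_integrable[OF intD] set_integrable_phi)
    finally show ?thesis .
  qed
  have "\<bar>D\<bar> \<le> (LINT y:{..x}|lborel. \<bar>(h y - h x) * phi y\<bar>)"
    using integral_norm_bound[of lborel "\<lambda>y. indicator {..x} y *\<^sub>R ((h y - h x) * phi y)"]
    by (simp add: D_def set_lebesgue_integral_def abs_mult)
  \<comment> \<open>For \<open>y \<le> x\<close> the Lipschitz bound reads
    \<open>\<bar>h y - h x\<bar> \<le> x - y\<close>, and the tail integral of \<open>x - y\<close>
    is exactly \<open>E\<close>.\<close>
  also have "\<dots> \<le> (LINT y:{..x}|lborel. x * phi y - y * phi y)"
  proof (intro set_integral_mono integrable_imp_set_integrable integrable_abs intD)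
    show "integrable lborel (\<lambda>y. x * phi y - y * phi y)"
      using integrable_power_phi[of 0] integrable_power_phi[of 1] by simp
    show "\<bar>(h y - h x) * phi y\<bar> \<le> x * phi y - y * phi y" if "y \<in> {..x}" for y
      using mult_right_mono[OF lip[of y x], of "phi y"] that
      by (simp only: abs_mult left_diff_distrib[of x, symmetric] abs_of_nonneg normal_density_nonneg) simp
  qed auto
  also have "\<dots> = E"
    using set_integrable_power_phi[of "{..x}" 1] set_integrable_phi[of "{..x}"]
    by (subst set_integral_diff) (simp_all add: first_moment_Iic_phi Phi_def E_def)
  finally have D: "\<bar>D\<bar> \<le> E" .
  have "x * stein_kernel h m x + (h x - m) * phi x = x * D + (h x - m) * E"
    by (simp add: split E_def algebra_simps)
  also have "\<bar>\<dots>\<bar> \<le> \<bar>x\<bar> * E + (\<bar>x\<bar> + 1) * E"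
    using D by (intro order.trans[OF abs_triangle_ineq] add_mono) (auto simp: abs_mult intro!: mult_mono gr)
  also have "\<dots> = (2 * \<bar>x\<bar> + 1) * E" by (simp add: algebra_simps)
  also have "\<dots> \<le> (2 * \<bar>x\<bar> + 1) * (phi x / (1 + x\<^sup>2))"
    unfolding E_def using x by (intro mult_left_mono Phi_Mills_defect) auto
  also have "\<dots> = (2 * \<bar>x\<bar> + 1) / (1 + x\<^sup>2) * phi x" by simp
  also have "\<dots> \<le> 3 * phi x"
  proof (rule mult_right_mono)
    have "2 * \<bar>x\<bar> \<le> x\<^sup>2 + 1"
      using zero_le_power2[of "\<bar>x\<bar> - 1"] by (simp add: power2_diff)
    then have "2 * \<bar>x\<bar> + 1 \<le> x\<^sup>2 + 2" by simp
    also have "\<dots> \<le> 3 * (1 + x\<^sup>2)" by simp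
    finally have "2 * \<bar>x\<bar> + 1 \<le> 3 * (1 + x\<^sup>2)" .
    then show "(2 * \<bar>x\<bar> + 1) / (1 + x\<^sup>2) \<le> 3"
      by (simp add: divide_le_eq add_pos_nonneg)
  qed simp
  finally show ?thesis .
qed

text \<open>Total integral zero makes the right tail the negative of the left one, and reflection
  turns the right tail into a left one.\<close>

lemma set_integral_Iic_reflect:
  fixes g :: "real \<Rightarrow> real"
  assumes g: "integrable lborel g" "(LINT y|lborel. g y) = 0"
  shows "(LINT y:{..-x}|lborel. g (- y)) = - (LINT y:{..x}|lborel. g y)"
proof -
  have "(LINT y:{..-x}|lborel. g (- y)) = (LINT y:{x..}|lborel. g y)"
    unfolding set_lebesgue_integral_def
    by (subst lborel_integral_real_affine[of "-1" _ 0])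
       (auto intro!: Bochner_Integration.integral_cong simp: indicator_def)
  moreover have "(LINT y:{x..}|lborel. g y) + (LINT y:{..x}|lborel. g y) = (LINT y|lborel. g y)"
  proof -
    have "(LINT y:{x..}|lborel. g y) + (LINT y:{..x}|lborel. g y)
        = (LINT y|lborel. indicator {x..} y *\<^sub>R g y + indicator {..x} y *\<^sub>R g y)"
      unfolding set_lebesgue_integral_def
      by (intro Bochner_Integration.integral_add[symmetric] integrable_mult_indicator g) auto
    also have "\<dots> = (LINT y|lborel. g y)"
      by (rule integral_cong_AE)
         (use g(1) AE_lborel_singleton[of x] in \<open>auto split: split_indicator elim!: eventually_mono\<close>)
    finally show ?thesis .
  qed
  ultimately show ?thesis using g by simp
qed

text \<open>For \<open>x > 0\<close> the bound on the negative half-line is applied to the reflected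
  function \<open>h (- y)\<close>; centring makes the two kernels agree up to sign.\<close>

lemma stein_derivative_bound:
  assumes int: "integrable lborel (\<lambda>y. (h y - m) * phi y)" and mean: "(LINT y|lborel. (h y - m) * phi y) = 0"
    and h: "(\<forall>y. \<bar>h y - m\<bar> \<le> 1) \<or> (\<forall>y z. \<bar>h y - h z\<bar> \<le> \<bar>y - z\<bar>) \<and> (\<forall>y. \<bar>h y - m\<bar> \<le> \<bar>y\<bar> + 1)"
  shows "\<bar>x * stein_kernel h m x + (h x - m) * phi x\<bar> \<le> 3 * phi x"
proof (cases "x \<le> 0")
  case True
  with int h show ?thesis by (rule stein_derivative_bound_neg)
next
  case False
  have "stein_kernel (\<lambda>y. h (- y)) m (- x) = - stein_kernel h m x"
    using set_integral_Iic_reflect[OF int mean, of x] by (simp add: stein_kernel_def)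
  moreover have "\<bar>- x * stein_kernel (\<lambda>y. h (- y)) m (- x) + (h (- (- x)) - m) * phi (- x)\<bar> \<le> 3 * phi (- x)"
  proof (rule stein_derivative_bound_neg)
    show "integrable lborel (\<lambda>y. (h (- y) - m) * phi y)"
      using lborel_integrable_real_affine[OF int, of "-1" 0] by simp
    have "\<bar>- y - - z\<bar> = \<bar>y - z\<bar>" for y z :: real by simp
    with h show "(\<forall>y. \<bar>h (- y) - m\<bar> \<le> 1) \<or>
        (\<forall>y z. \<bar>h (- y) - h (- z)\<bar> \<le> \<bar>y - z\<bar>) \<and> (\<forall>y. \<bar>h (- y) - m\<bar> \<le> \<bar>y\<bar> + 1)"
      by (metis abs_minus_cancel)
  qed (use False in simp)
  ultimately show ?thesis by simp
qed

text \<open>Because \<open>phi\<close> has derivative \<open>- x * phi x\<close>, the quotient of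
  the kernel by \<open>phi\<close> solves the equation. Continuity of \<open>h\<close> makes
  \<open>f'\<close> continuous, as the later integration by parts requires.\<close>

lemma stein_solution_exists:
  assumes cont: "continuous_on UNIV h"
    and int: "integrable lborel (\<lambda>y. h y * phi y)" and m: "m = (LINT y|lborel. h y * phi y)"
    and h: "(\<forall>y. \<bar>h y - m\<bar> \<le> 1) \<or> (\<forall>y z. \<bar>h y - h z\<bar> \<le> \<bar>y - z\<bar>) \<and> (\<forall>y. \<bar>h y - m\<bar> \<le> \<bar>y\<bar> + 1)"
  obtains f f' where "\<And>x. (f has_real_derivative f' x) (at x)" "continuous_on UNIV f'"
    "\<And>x. \<bar>f' x\<bar> \<le> 3" "\<And>x. f' x - x * f x = h x - m"
proof -
  let ?g = "\<lambda>y. (h y - m) * phi y"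
  have g: "?g = (\<lambda>y. h y * phi y - m * (y ^ 0 * phi y))" by (simp add: algebra_simps)
  have int': "integrable lborel ?g"
    unfolding g by (intro Bochner_Integration.integrable_diff int integrable_mult_right integrable_power_phi)
  have mean: "(LINT y|lborel. ?g y) = 0"
    unfolding g
    by (subst Bochner_Integration.integral_diff)
       (use int integrable_power_phi[of 0] in \<open>auto simp: m integral_phi\<close>)
  define f where "f x = stein_kernel h m x / phi x" for x
  define f' where "f' x = x * f x + (h x - m)" for x
  have der: "(f has_real_derivative f' x) (at x)" for x
  proof -
    have "(stein_kernel h m has_real_derivative ?g x) (at x)"
      unfolding stein_kernel_def
      by (rule set_integral_Iic_has_real_derivative[OF int']) (intro continuous_intros cont)
    then show ?thesis
      unfolding f_def f'_def using phi_pos[of x]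
      by (auto intro!: derivative_eq_intros simp: field_simps power2_eq_square)
  qed
  moreover have "continuous_on UNIV f"
    using der by (meson DERIV_isCont continuous_at_imp_continuous_on)
  then have "continuous_on UNIV f'"
    unfolding f'_def by (intro continuous_intros cont)
  moreover have "\<bar>f' x\<bar> \<le> 3" for x
  proof -
    have "f' x * phi x = x * stein_kernel h m x + (h x - m) * phi x"
      using phi_pos[of x] by (simp add: f'_def f_def field_simps)
    then have "\<bar>f' x\<bar> * phi x \<le> 3 * phi x"
      using stein_derivative_bound[OF int' mean h, of x] by (simp add: abs_mult flip: abs_mult_pos')
    then show ?thesis using phi_pos[of x] by simp
  qed
  moreover have "f' x - x * f x = h x - m" for x by (simp add: f'_def)
  ultimately show ?thesis by (rule that)
qed

section \<open>Independence from the joint characteristic function\<close>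

lemma (in prob_space) integrable_bounded_complex:
  fixes Z :: "'a \<Rightarrow> complex"
  assumes "Z \<in> borel_measurable M" "\<And>\<omega>. norm (Z \<omega>) \<le> B"
  shows "integrable M Z"
  using assms by (intro integrable_const_bound[of Z B]) auto

text \<open>Reweighting the measure by \<open>w\<close> divided by its mean gives a probability
  under which \<open>X\<close> has the characteristic function of \<open>N\<close>; Levy's
  uniqueness theorem identifies its law. If the mean is 0, \<open>w\<close> vanishes almost
  surely.\<close>

lemma (in prob_space) weighted_char_imp_indicator_nonneg:
  fixes w :: "'a \<Rightarrow> real" and N :: "real measure"
  assumes [measurable]: "X \<in> borel_measurable M" "w \<in> borel_measurable M" "A \<in> sets borel"
    and w: "\<And>\<omega>. 0 \<le> w \<omega>" "\<And>\<omega>. w \<omega> \<le> B" and N: "real_distribution N"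
    and char: "\<And>t. expectation (\<lambda>\<omega>. w \<omega> * iexp (t * X \<omega>)) = expectation w * char N t"
  shows "expectation (\<lambda>\<omega>. w \<omega> * indicator A (X \<omega>)) = expectation w * measure N A"
proof -
  interpret N: real_distribution N by fact
  let ?k = "expectation w"
  have int: "integrable M w"
    using w by (intro integrable_const_bound[of w B]) auto
  have k: "0 \<le> ?k" using w by (intro Bochner_Integration.integral_nonneg) auto
  show ?thesis
  proof (cases "?k = 0")
    case True
    then have "AE \<omega> in M. w \<omega> = 0"
      using integral_nonneg_eq_0_iff_AE[OF int] w by auto
    then have "expectation (\<lambda>\<omega>. w \<omega> * indicator A (X \<omega>)) = expectation (\<lambda>\<omega>. 0)"
      by (intro integral_cong_AE) auto
    then show ?thesis using True by simp
  next
    case False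
    then have k: "0 < ?k" using k by simp
    define Q where "Q = density M (\<lambda>\<omega>. ennreal (w \<omega> / ?k))"
    have sets_Q [measurable_cong]: "sets Q = sets M" by (simp add: Q_def)
    have "emeasure Q (space Q) = (\<integral>\<^sup>+\<omega>. ennreal (w \<omega> / ?k) \<partial>M)"
      unfolding Q_def by (subst emeasure_density) (auto intro!: nn_integral_cong)
    also have "\<dots> = ennreal (expectation (\<lambda>\<omega>. w \<omega> / ?k))"
      using w k int by (intro nn_integral_eq_integral) auto
    finally interpret Q: prob_space Q using k by (intro prob_spaceI) simp
    have D: "real_distribution (distr Q borel X)" by (intro Q.real_distribution_distr) measurable
    interpret D: real_distribution "distr Q borel X" by fact
    have "char (distr Q borel X) = char N"
    proof
      fix t
      have "char (distr Q borel X) t = (CLINT \<omega>|Q. iexp (t * X \<omega>))"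
        unfolding char_def by (subst integral_distr) auto
      also have "\<dots> = (CLINT \<omega>|M. (w \<omega> / ?k) *\<^sub>R iexp (t * X \<omega>))"
        unfolding Q_def using w k by (subst integral_density) auto
      also have "\<dots> = (CLINT \<omega>|M. (w \<omega> * iexp (t * X \<omega>)) / ?k)"
        by (simp add: scaleR_conv_of_real)
      also have "\<dots> = char N t" using k char[of t] by simp
      finally show "char (distr Q borel X) t = char N t" .
    qed
    then have eq: "distr Q borel X = N" by (intro Levy_uniqueness D N)
    have "measure N A = D.expectation (indicator A)" by (simp add: eq)
    also have "\<dots> = (LINT \<omega>|Q. indicator A (X \<omega>))" by (subst integral_distr) auto
    also have "\<dots> = expectation (\<lambda>\<omega>. (w \<omega> / ?k) *\<^sub>R indicator A (X \<omega>))"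
      unfolding Q_def using w k by (subst integral_density) auto
    also have "\<dots> = expectation (\<lambda>\<omega>. w \<omega> * indicator A (X \<omega>)) / ?k"
      by simp
    finally show ?thesis using k by simp
  qed
qed

text \<open>Adding a constant makes a bounded real weight nonnegative.\<close>

lemma (in prob_space) weighted_char_imp_indicator_real:
  fixes w :: "'a \<Rightarrow> real" and N :: "real measure"
  assumes [measurable]: "X \<in> borel_measurable M" "w \<in> borel_measurable M" "A \<in> sets borel"
    and w: "\<And>\<omega>. \<bar>w \<omega>\<bar> \<le> B" and N: "real_distribution N"
    and X: "\<And>t. expectation (\<lambda>\<omega>. iexp (t * X \<omega>)) = char N t"
    and char: "\<And>t. expectation (\<lambda>\<omega>. w \<omega> * iexp (t * X \<omega>)) = expectation w * char N t"
  shows "expectation (\<lambda>\<omega>. w \<omega> * indicator A (X \<omega>)) = expectation w * measure N A"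
proof -
  have B: "0 \<le> B" using w[of undefined] by linarith
  have int: "integrable M w"
    using w by (intro integrable_const_bound[of w B]) auto
  have intA: "integrable M (\<lambda>\<omega>. indicator A (X \<omega>) :: real)"
    by (intro integrable_const_bound[of _ 1]) (auto simp: indicator_def)
  have intwA: "integrable M (\<lambda>\<omega>. w \<omega> * indicator A (X \<omega>))"
    using w B by (intro integrable_const_bound[of _ B]) (auto simp: indicator_def)
  have int1: "integrable M (\<lambda>\<omega>. iexp (t * X \<omega>))" for t
    by (intro integrable_bounded_complex[of _ 1]) auto
  have intw1: "integrable M (\<lambda>\<omega>. w \<omega> * iexp (t * X \<omega>))" for t
    using w by (intro integrable_bounded_complex[of _ B]) (auto simp: norm_mult)
  have X': "expectation (\<lambda>\<omega>. indicator A (X \<omega>)) = measure N A"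
    using weighted_char_imp_indicator_nonneg[of X "\<lambda>_. 1" A 1 N] N X by (simp add: prob_space)
  have "expectation (\<lambda>\<omega>. (w \<omega> + B) * indicator A (X \<omega>)) = expectation (\<lambda>\<omega>. w \<omega> + B) * measure N A"
  proof (rule weighted_char_imp_indicator_nonneg[where B = "2 * B"])
    show "0 \<le> w \<omega> + B" "w \<omega> + B \<le> 2 * B" for \<omega> using w[of \<omega>] by linarith+
    show "expectation (\<lambda>\<omega>. (w \<omega> + B) * iexp (t * X \<omega>)) = expectation (\<lambda>\<omega>. w \<omega> + B) * char N t" for t
      using int int1[of t] intw1[of t] char[of t] X[of t]
      by (simp add: distrib_right prob_space)
  qed (use N in auto)
  then show ?thesis
    using int intA intwA X' by (simp add: distrib_right prob_space)
qed

text \<open>A real characteristic function is even, so conjugating the hypothesis at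
  \<open>- t\<close> gives it for \<open>cnj (Z \<omega>)\<close>; averaging the two yields the
  hypothesis for the real part.\<close>

lemma (in prob_space) weighted_char_imp_indicator_Re:
  fixes Z :: "'a \<Rightarrow> complex" and N :: "real measure"
  assumes [measurable]: "X \<in> borel_measurable M" "Z \<in> borel_measurable M" "A \<in> sets borel"
    and Z: "\<And>\<omega>. norm (Z \<omega>) \<le> B" and N: "real_distribution N"
    and X: "\<And>t. expectation (\<lambda>\<omega>. iexp (t * X \<omega>)) = char N t"
    and real: "\<And>t. char N t \<in> \<real>"
    and char: "\<And>t. expectation (\<lambda>\<omega>. Z \<omega> * iexp (t * X \<omega>)) = expectation Z * char N t"
  shows "expectation (\<lambda>\<omega>. Re (Z \<omega>) * indicator A (X \<omega>)) = expectation (\<lambda>\<omega>. Re (Z \<omega>)) * measure N A"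
proof -
  have intZ: "integrable M Z" using Z by (intro integrable_bounded_complex) auto
  have int: "integrable M (\<lambda>\<omega>. Z \<omega> * iexp (t * X \<omega>))" for t
    using Z by (intro integrable_bounded_complex[of _ B]) (auto simp: norm_mult)
  have even: "char N (- t) = char N t" for t
  proof -
    have "char N (- t) = (CLINT x|N. cnj (iexp (t * x)))"
      by (simp add: char_def exp_cnj)
    also have "\<dots> = cnj (char N t)"
      unfolding char_def by (rule Bochner_Integration.integral_cnj[of N "\<lambda>x. iexp (t * x)"])
    finally have "char N (- t) = cnj (char N t)" .
    then show ?thesis using real[of t] by (simp add: Reals_cnj_iff)
  qed
  have conj: "expectation (\<lambda>\<omega>. cnj (Z \<omega>) * iexp (t * X \<omega>)) = expectation (\<lambda>\<omega>. cnj (Z \<omega>)) * char N t" for t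
  proof -
    have "expectation (\<lambda>\<omega>. cnj (Z \<omega>) * iexp (t * X \<omega>)) = expectation (\<lambda>\<omega>. cnj (Z \<omega> * iexp (- t * X \<omega>)))"
      by (simp add: exp_cnj)
    also have "\<dots> = cnj (expectation Z * char N (- t))"
      unfolding Bochner_Integration.integral_cnj char ..
    finally show ?thesis using real[of t] by (simp add: even Reals_cnj_iff)
  qed
  have [measurable]: "(\<lambda>\<omega>. cnj (Z \<omega>)) \<in> borel_measurable M"
    by (rule borel_measurable_continuous_on[of cnj]) (auto intro!: continuous_intros)
  have intc: "integrable M (\<lambda>\<omega>. cnj (Z \<omega>) * iexp (t * X \<omega>))" for t
    using Z by (intro integrable_bounded_complex[of _ B]) (auto simp: norm_mult)
  have intcZ: "integrable M (\<lambda>\<omega>. cnj (Z \<omega>))"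
    using Z by (intro integrable_bounded_complex[of _ B]) auto
  show ?thesis
  proof (rule weighted_char_imp_indicator_real[where B = B])
    show "\<bar>Re (Z \<omega>)\<bar> \<le> B" for \<omega> using Z abs_Re_le_cmod order_trans by blast
    fix t
    have eq: "of_real (Re z) = (z + cnj z) / 2" for z by (simp add: complex_add_cnj)
    show "expectation (\<lambda>\<omega>. Re (Z \<omega>) * iexp (t * X \<omega>)) = expectation (\<lambda>\<omega>. Re (Z \<omega>)) * char N t"
      unfolding integral_complex_of_real[symmetric] eq
      using int[of t] intc[of t] intZ intcZ char[of t] conj[of t]
      by (simp add: add_divide_distrib distrib_right)
  qed (use N X in auto)
qed

text \<open>The imaginary part of \<open>Z\<close> is the real part of \<open>- \<i> * Z\<close>, so
  the preceding result covers both parts.\<close>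

lemma (in prob_space) weighted_char_imp_indicator:
  fixes Z :: "'a \<Rightarrow> complex" and N :: "real measure"
  assumes [measurable]: "X \<in> borel_measurable M" "Z \<in> borel_measurable M" "A \<in> sets borel"
    and Z: "\<And>\<omega>. norm (Z \<omega>) \<le> B" and N: "real_distribution N"
    and X: "\<And>t. expectation (\<lambda>\<omega>. iexp (t * X \<omega>)) = char N t"
    and real: "\<And>t. char N t \<in> \<real>"
    and char: "\<And>t. expectation (\<lambda>\<omega>. Z \<omega> * iexp (t * X \<omega>)) = expectation Z * char N t"
  shows "expectation (\<lambda>\<omega>. Z \<omega> * indicator A (X \<omega>)) = expectation Z * measure N A"
proof -
  have intZ: "integrable M Z" using Z by (intro integrable_bounded_complex) auto
  have intA: "integrable M (\<lambda>\<omega>. Z \<omega> * indicator A (X \<omega>))"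
    using Z order_trans[OF norm_ge_zero Z]
    by (intro integrable_bounded_complex[of _ B]) (auto simp: norm_mult indicator_def)
  have Re: "expectation (\<lambda>\<omega>. Re (Z \<omega>) * indicator A (X \<omega>)) = expectation (\<lambda>\<omega>. Re (Z \<omega>)) * measure N A"
    by (rule weighted_char_imp_indicator_Re[OF assms])
  have "expectation (\<lambda>\<omega>. Re (- \<i> * Z \<omega>) * indicator A (X \<omega>))
      = expectation (\<lambda>\<omega>. Re (- \<i> * Z \<omega>)) * measure N A"
  proof (rule weighted_char_imp_indicator_Re[where B = B])
    show "expectation (\<lambda>\<omega>. - \<i> * Z \<omega> * iexp (t * X \<omega>)) = expectation (\<lambda>\<omega>. - \<i> * Z \<omega>) * char N t" for t
      using char[of t] by (simp add: mult.assoc)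
  qed (use Z N X real in \<open>auto simp: norm_mult\<close>)
  then have Im: "expectation (\<lambda>\<omega>. Im (Z \<omega>) * indicator A (X \<omega>)) = expectation (\<lambda>\<omega>. Im (Z \<omega>)) * measure N A"
    by simp
  show ?thesis
  proof (rule complex_eqI)
    have "Re (expectation (\<lambda>\<omega>. Z \<omega> * indicator A (X \<omega>))) = expectation (\<lambda>\<omega>. Re (Z \<omega>) * indicator A (X \<omega>))"
      by (subst integral_Re[OF intA, symmetric]) (auto simp: indicator_def intro!: Bochner_Integration.integral_cong)
    then show "Re (expectation (\<lambda>\<omega>. Z \<omega> * indicator A (X \<omega>))) = Re (expectation Z * measure N A)"
      using Re integral_Re[OF intZ] by simp
    have "Im (expectation (\<lambda>\<omega>. Z \<omega> * indicator A (X \<omega>))) = expectation (\<lambda>\<omega>. Im (Z \<omega>) * indicator A (X \<omega>))"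
      by (subst integral_Im[OF intA, symmetric]) (auto simp: indicator_def intro!: Bochner_Integration.integral_cong)
    then show "Im (expectation (\<lambda>\<omega>. Z \<omega> * indicator A (X \<omega>))) = Im (expectation Z * measure N A)"
      using Im integral_Im[OF intZ] by simp
  qed
qed

lemma char_std_normal_real: "char std_normal_distribution t \<in> \<real>"
  by (simp add: char_std_normal_distribution)

text \<open>The coordinates in \<open>J\<close> are peeled off one at a time: an event of one coordinate is
  inserted while the others are tested against events (if already peeled) or characters.\<close>

lemma (in prob_space) mixed_char_indicator:
  fixes \<zeta> :: "'i \<Rightarrow> 'a \<Rightarrow> real"
  assumes K: "finite K" and [measurable]: "\<And>k. k \<in> K \<Longrightarrow> \<zeta> k \<in> borel_measurable M"
    and char: "\<And>c. expectation (\<lambda>\<omega>. iexp (\<Sum>k\<in>K. c k * \<zeta> k \<omega>))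
        = (\<Prod>k\<in>K. char std_normal_distribution (c k))"
    and J: "finite J" "J \<subseteq> K" and [measurable]: "\<And>k. A k \<in> sets borel"
  shows "expectation (\<lambda>\<omega>. (\<Prod>k\<in>J. indicator (A k) (\<zeta> k \<omega>)) * iexp (\<Sum>k\<in>K - J. c k * \<zeta> k \<omega>))
    = (\<Prod>k\<in>J. of_real (measure std_normal_distribution (A k)))
      * (\<Prod>k\<in>K - J. char std_normal_distribution (c k))"
  using J
proof (induction J arbitrary: c rule: finite_induct)
  case empty
  then show ?case using char[of c] by simp
next
  case (insert k J)
  let ?N = std_normal_distribution
  let ?R = "K - insert k J"
  have k: "k \<in> K" "k \<notin> J" and JK: "J \<subseteq> K" using insert by auto
  have [measurable]: "\<zeta> k \<in> borel_measurable M" using k by simp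
  have KJ: "K - J = insert k ?R" using k by auto
  have R: "finite ?R" "k \<notin> ?R" using K by auto
  define Z where "Z \<omega> = (\<Prod>k\<in>J. indicator (A k) (\<zeta> k \<omega>)) * iexp (\<Sum>k\<in>?R. c k * \<zeta> k \<omega>)" for \<omega>
  have [measurable]: "\<And>l. l \<in> J \<Longrightarrow> \<zeta> l \<in> borel_measurable M" "\<And>l. l \<in> ?R \<Longrightarrow> \<zeta> l \<in> borel_measurable M"
    using JK by auto
  have Zm: "Z \<in> borel_measurable M" unfolding Z_def by measurable
  have Zb: "norm (Z \<omega>) \<le> 1" for \<omega>
    unfolding Z_def norm_mult prod_norm[symmetric]
    by (auto intro!: mult_le_one prod_le_1 prod_nonneg simp: indicator_def)
  \<comment> \<open>The induction hypothesis still tests coordinate \<open>k\<close> against a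
    character; its frequency is freed by replacing \<open>c\<close> with \<open>c(k := t)\<close>.
    The case \<open>t = 0\<close> computes the mean of \<open>Z\<close>.\<close>
  have step: "expectation (\<lambda>\<omega>. Z \<omega> * iexp (t * \<zeta> k \<omega>))
      = (\<Prod>k\<in>J. of_real (measure ?N (A k))) * (\<Prod>k\<in>?R. char ?N (c k)) * char ?N t" for t
  proof -
    have "(\<Sum>l\<in>K - J. (c(k := t)) l * \<zeta> l \<omega>) = t * \<zeta> k \<omega> + (\<Sum>l\<in>?R. c l * \<zeta> l \<omega>)" for \<omega>
      unfolding KJ using R by (subst sum.insert) (auto intro!: sum.cong)
    then have "Z \<omega> * iexp (t * \<zeta> k \<omega>)
        = (\<Prod>k\<in>J. indicator (A k) (\<zeta> k \<omega>)) * iexp (\<Sum>l\<in>K - J. (c(k := t)) l * \<zeta> l \<omega>)" for \<omega>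
      by (simp add: Z_def distrib_left exp_add mult_ac)
    then have "expectation (\<lambda>\<omega>. Z \<omega> * iexp (t * \<zeta> k \<omega>))
        = (\<Prod>k\<in>J. of_real (measure ?N (A k))) * (\<Prod>l\<in>K - J. char ?N ((c(k := t)) l))"
      using insert.IH[OF JK, of "c(k := t)"] by simp
    also have "(\<Prod>l\<in>K - J. char ?N ((c(k := t)) l)) = char ?N t * (\<Prod>l\<in>?R. char ?N (c l))"
      unfolding KJ using R by (subst prod.insert) (auto intro!: prod.cong)
    finally show ?thesis by (simp add: mult_ac)
  qed
  have Z0: "expectation Z = (\<Prod>k\<in>J. of_real (measure ?N (A k))) * (\<Prod>k\<in>?R. char ?N (c k))"
    using step[of 0] by (simp add: char_std_normal_distribution)
  have "expectation (\<lambda>\<omega>. Z \<omega> * indicator (A k) (\<zeta> k \<omega>)) = expectation Z * measure ?N (A k)"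
  proof (rule weighted_char_imp_indicator[OF _ Zm _ Zb])
    show "real_distribution ?N" by (rule real_dist_normal_dist)
    show "expectation (\<lambda>\<omega>. iexp (t * \<zeta> k \<omega>)) = char ?N t" for t
    proof -
      have "(\<Sum>l\<in>K. ((\<lambda>_. 0)(k := t)) l * \<zeta> l \<omega>) = t * \<zeta> k \<omega>" for \<omega>
        using K k by (subst sum.remove[of K k]) auto
      moreover have "(\<Prod>l\<in>K. char ?N (((\<lambda>_. 0)(k := t)) l)) = char ?N t"
        using K k by (subst prod.remove[of K k]) (auto simp: char_std_normal_distribution)
      ultimately show ?thesis using char[of "(\<lambda>_. 0)(k := t)"] by simp
    qed
    show "expectation (\<lambda>\<omega>. Z \<omega> * iexp (t * \<zeta> k \<omega>)) = expectation Z * char ?N t" for t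
      using step[of t] Z0 by simp
  qed (auto intro: char_std_normal_real)
  moreover have eq: "(\<Prod>l\<in>insert k J. indicator (A l) (\<zeta> l \<omega>)) * iexp (\<Sum>l\<in>?R. c l * \<zeta> l \<omega>)
      = Z \<omega> * indicator (A k) (\<zeta> k \<omega>)" for \<omega>
    using insert.hyps by (simp add: Z_def mult_ac)
  ultimately show ?case
    unfolding eq prod.insert[OF insert.hyps] by (simp only: Z0 mult_ac)
qed

text \<open>When all coordinates have been peeled no character is left, and the formula is the
  product rule for events. Coordinates outside the chosen subset get the whole line as their
  event.\<close>

lemma (in prob_space) char_imp_indep_std_normal:
  fixes \<zeta> :: "'i \<Rightarrow> 'a \<Rightarrow> real"
  assumes K: "finite K" and meas: "\<And>k. k \<in> K \<Longrightarrow> \<zeta> k \<in> borel_measurable M"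
    and char: "\<And>c. expectation (\<lambda>\<omega>. iexp (\<Sum>k\<in>K. c k * \<zeta> k \<omega>))
        = (\<Prod>k\<in>K. char std_normal_distribution (c k))"
  shows "indep_vars (\<lambda>_. borel) \<zeta> K"
    and "\<And>k. k \<in> K \<Longrightarrow> distr M borel (\<zeta> k) = std_normal_distribution"
proof -
  let ?N = std_normal_distribution
  interpret N: real_distribution ?N by (rule real_dist_normal_dist)
  have prod: "prob (\<Inter>k\<in>J. \<zeta> k -` A k \<inter> space M) = (\<Prod>k\<in>J. measure ?N (A k))"
    if "J \<subseteq> K" "J \<noteq> {}" "\<And>k. A k \<in> sets borel" for J and A :: "'i \<Rightarrow> real set"
  proof -
    have J: "finite J" using that K finite_subset by auto
    define B where "B k = (if k \<in> J then A k else UNIV)" for k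
    have B: "B k \<in> sets borel" for k using that by (simp add: B_def)
    have ev: "(\<Inter>k\<in>J. \<zeta> k -` A k \<inter> space M) \<in> events"
      using that J meas by (intro sets.finite_INT) (auto intro!: measurable_sets)
    have "(\<Prod>k\<in>K. indicator (B k) (\<zeta> k \<omega>)) = (indicator (\<Inter>k\<in>J. \<zeta> k -` A k \<inter> space M) \<omega> :: complex)"
      if \<omega>: "\<omega> \<in> space M" for \<omega>
    proof -
      have "(\<Prod>k\<in>K. indicator (B k) (\<zeta> k \<omega>)) = (\<Prod>k\<in>J. indicator (A k) (\<zeta> k \<omega>) :: complex)"
        using \<open>J \<subseteq> K\<close> K by (intro prod.mono_neutral_cong_right) (auto simp: B_def)
      also have "\<dots> = indicator (\<Inter>k\<in>J. \<zeta> k -` A k \<inter> space M) \<omega>"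
        using J \<omega> \<open>J \<noteq> {}\<close> by (auto simp: indicator_def prod_zero_iff)
      finally show ?thesis .
    qed
    then have "expectation (\<lambda>\<omega>. \<Prod>k\<in>K. indicator (B k) (\<zeta> k \<omega>))
        = (expectation (\<lambda>\<omega>. indicator (\<Inter>k\<in>J. \<zeta> k -` A k \<inter> space M) \<omega> :: complex))"
      by (intro Bochner_Integration.integral_cong) auto
    also have "\<dots> = expectation (\<lambda>\<omega>. complex_of_real (indicator (\<Inter>k\<in>J. \<zeta> k -` A k \<inter> space M) \<omega>))"
      by (intro Bochner_Integration.integral_cong) (auto simp: indicator_def)
    also have "\<dots> = complex_of_real (prob (\<Inter>k\<in>J. \<zeta> k -` A k \<inter> space M))"
      unfolding integral_complex_of_real Bochner_Integration.integral_indicator Int_absorb2[OF sets.sets_into_space[OF ev]] ..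
    finally have "complex_of_real (prob (\<Inter>k\<in>J. \<zeta> k -` A k \<inter> space M))
        = (\<Prod>k\<in>K. of_real (measure ?N (B k)))"
      using mixed_char_indicator[OF K meas char K order.refl B] by simp
    also have "\<dots> = (\<Prod>k\<in>J. of_real (measure ?N (A k)))"
      using \<open>J \<subseteq> K\<close> K N.prob_space
      by (intro prod.mono_neutral_cong_right)
         (auto simp: B_def)
    finally show ?thesis unfolding of_real_prod[symmetric] of_real_eq_iff .
  qed
  have single: "prob (\<zeta> k -` A \<inter> space M) = measure ?N A" if "k \<in> K" "A \<in> sets borel" for k A
    using prod[of "{k}" "\<lambda>_. A"] that by simp
  show "distr M borel (\<zeta> k) = ?N" if "k \<in> K" for k
  proof (rule measure_eqI)
    fix A assume "A \<in> sets (distr M borel (\<zeta> k))"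
    then have A: "A \<in> sets borel" by simp
    show "emeasure (distr M borel (\<zeta> k)) A = emeasure ?N A"
      using A that single[OF that A] meas[OF that]
      by (simp add: emeasure_distr emeasure_eq_measure N.emeasure_eq_measure)
  qed simp
  show "indep_vars (\<lambda>_. borel) \<zeta> K"
    unfolding indep_vars_def2 indep_sets_def
  proof (intro conjI ballI allI impI)
    fix J F assume J: "J \<subseteq> K" "J \<noteq> {}" "finite J"
      and F: "F \<in> Pi J (\<lambda>i. {\<zeta> i -` A \<inter> space M |A. A \<in> sets borel})"
    then have "\<forall>i\<in>J. \<exists>A. A \<in> sets borel \<and> F i = \<zeta> i -` A \<inter> space M" by (auto simp: Pi_iff)
    then obtain A where A: "\<And>i. i \<in> J \<Longrightarrow> A i \<in> sets borel \<and> F i = \<zeta> i -` A i \<inter> space M"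
      by metis
    define A' where "A' i = (if i \<in> J then A i else UNIV)" for i
    have A': "A' i \<in> sets borel" for i using A by (simp add: A'_def)
    have F': "F i = \<zeta> i -` A' i \<inter> space M" if "i \<in> J" for i using A that by (simp add: A'_def)
    have "prob (\<Inter>i\<in>J. F i) = prob (\<Inter>i\<in>J. \<zeta> i -` A' i \<inter> space M)" using F' by simp
    also have "\<dots> = (\<Prod>i\<in>J. measure ?N (A' i))" by (rule prod) (use J A' in auto)
    also have "\<dots> = (\<Prod>i\<in>J. prob (F i))"
      using J F' A' single by (intro prod.cong) (auto simp: subset_iff)
    finally show "prob (\<Inter>i\<in>J. F i) = (\<Prod>i\<in>J. prob (F i))" .
  qed (use meas in \<open>auto intro!: measurable_sets\<close>)
qed

section \<open>Normal approximation in the second Wiener chaos\<close>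

lemma std_normal_integral:
  fixes g :: "real \<Rightarrow> real"
  assumes "g \<in> borel_measurable borel"
  shows "(LINT x|std_normal_distribution. g x) = (LINT x|lborel. g x * phi x)"
  using assms by (subst integral_density) (auto simp: mult.commute)

lemma std_normal_integrable_iff:
  fixes g :: "real \<Rightarrow> real"
  assumes "g \<in> borel_measurable borel"
  shows "integrable std_normal_distribution g \<longleftrightarrow> integrable lborel (\<lambda>x. g x * phi x)"
  using assms by (subst integrable_density) (auto simp: mult.commute)

lemma lipschitz_of_bounded_derivative:
  fixes f :: "real \<Rightarrow> real"
  assumes "\<And>x. (f has_real_derivative f' x) (at x)" "\<And>x. \<bar>f' x\<bar> \<le> B"
  shows "\<bar>f x - f y\<bar> \<le> B * \<bar>x - y\<bar>"
proof -
  have "norm (f x - f y) \<le> B * norm (x - y)"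
    by (rule field_differentiable_bound[of UNIV]) (use assms in \<open>auto intro: has_field_derivative_at_within\<close>)
  then show ?thesis by simp
qed

text \<open>\<open>(z\<^sup>2 - 1) * phi z\<close> is the derivative of \<open>- z * phi z\<close>,
  and the chain rule contributes \<open>2 * a * z\<close>. The number \<open>r\<close> stands for
  the sum of the other chaos terms, held fixed.\<close>

lemma std_normal_ibp_square:
  fixes f f' :: "real \<Rightarrow> real"
  assumes der: "\<And>x. (f has_real_derivative f' x) (at x)" and cont: "continuous_on UNIV f'"
    and bd: "\<And>x. \<bar>f' x\<bar> \<le> B"
  shows "(LINT z|std_normal_distribution. (z\<^sup>2 - 1) * f (a * (z\<^sup>2 - 1) + r))
       = (LINT z|std_normal_distribution. 2 * a * z\<^sup>2 * f' (a * (z\<^sup>2 - 1) + r))"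
proof -
  \<comment> \<open>A bounded derivative gives linear growth of \<open>f\<close>, hence growth like
    \<open>1 + z\<^sup>2\<close> in \<open>z\<close>; \<open>C\<close> is the resulting constant. It
    secures integrability and kills the boundary terms.\<close>
  define C where "C = \<bar>f 0\<bar> + B * (\<bar>a\<bar> + \<bar>r\<bar>)"
  have B: "0 \<le> B" using bd[of 0] by linarith
  have C: "0 \<le> C" using B by (simp add: C_def)
  have contf: "continuous_on UNIV f"
    using der by (meson DERIV_isCont continuous_at_imp_continuous_on)
  note [continuous_intros] = continuous_on_compose2[OF contf] continuous_on_compose2[OF cont]
  have [measurable]: "f \<in> borel_measurable borel" "f' \<in> borel_measurable borel"
    using contf cont by (auto intro: borel_measurable_continuous_onI)
  have growth: "\<bar>f (a * (z\<^sup>2 - 1) + r)\<bar> \<le> C * (1 + z\<^sup>2)" for z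
  proof -
    have "\<bar>z\<^sup>2 - 1\<bar> \<le> 1 + z\<^sup>2" using zero_le_power2[of z] by (intro abs_leI) linarith+
    then have "\<bar>a * (z\<^sup>2 - 1) + r\<bar> \<le> \<bar>a\<bar> * (1 + z\<^sup>2) + \<bar>r\<bar> * (1 + z\<^sup>2)"
      using mult_left_mono[of "\<bar>z\<^sup>2 - 1\<bar>" "1 + z\<^sup>2" "\<bar>a\<bar>"]
      by (intro order.trans[OF abs_triangle_ineq] add_mono) (simp_all add: abs_mult distrib_left)
    then have "B * \<bar>a * (z\<^sup>2 - 1) + r\<bar> \<le> B * ((\<bar>a\<bar> + \<bar>r\<bar>) * (1 + z\<^sup>2))"
      using B by (intro mult_left_mono) (auto simp: distrib_right)
    moreover have "\<bar>f (a * (z\<^sup>2 - 1) + r) - f 0\<bar> \<le> B * \<bar>a * (z\<^sup>2 - 1) + r\<bar>"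
      using lipschitz_of_bounded_derivative[OF der bd, of "a * (z\<^sup>2 - 1) + r" 0] by simp
    moreover have "\<bar>f 0\<bar> \<le> \<bar>f 0\<bar> * (1 + z\<^sup>2)" by (simp add: distrib_left)
    ultimately have "\<bar>f (a * (z\<^sup>2 - 1) + r)\<bar> \<le> \<bar>f 0\<bar> * (1 + z\<^sup>2) + B * ((\<bar>a\<bar> + \<bar>r\<bar>) * (1 + z\<^sup>2))"
      by linarith
    then show ?thesis by (simp add: C_def algebra_simps)
  qed
  let ?u = "\<lambda>z. (z\<^sup>2 - 1) * f (a * (z\<^sup>2 - 1) + r)" and ?v = "\<lambda>z. 2 * a * z\<^sup>2 * f' (a * (z\<^sup>2 - 1) + r)"
  let ?F = "\<lambda>z. - (z * phi z * f (a * (z\<^sup>2 - 1) + r))"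
  have sq: "(1 + z\<^sup>2)\<^sup>2 \<le> 2 * (1 + z ^ 4)" for z :: real
    using zero_le_power2[of "z\<^sup>2 - 1"] by (simp add: power2_sum power2_diff)
  have intu: "integrable lborel (\<lambda>z. ?u z * phi z)"
  proof (rule integrable_phi_bound[of _ "2 * C" 2])
    fix z
    have "\<bar>?u z\<bar> \<le> (1 + z\<^sup>2) * (C * (1 + z\<^sup>2))"
      unfolding abs_mult
      using zero_le_power2[of z] by (intro mult_mono growth abs_leI) (linarith | simp)+
    also have "\<dots> = C * (1 + z\<^sup>2)\<^sup>2" by (simp add: power2_eq_square)
    also have "\<dots> \<le> C * (2 * (1 + z ^ 4))" by (intro mult_left_mono sq C)
    finally show "\<bar>?u z\<bar> \<le> 2 * C * (1 + z ^ (2 * 2))" by (simp add: algebra_simps)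
  qed measurable
  have intv: "integrable lborel (\<lambda>z. ?v z * phi z)"
  proof (rule integrable_phi_bound[of _ "2 * \<bar>a\<bar> * B" 1])
    fix z
    have "\<bar>?v z\<bar> \<le> 2 * \<bar>a\<bar> * z\<^sup>2 * B"
      unfolding abs_mult by (intro mult_mono bd) auto
    also have "\<dots> \<le> 2 * \<bar>a\<bar> * B * (1 + z\<^sup>2)"
      using B by (simp add: algebra_simps)
    finally show "\<bar>?v z\<bar> \<le> 2 * \<bar>a\<bar> * B * (1 + z ^ (2 * 1))" by simp
  qed measurable
  have "(LINT z|lborel. ?u z * phi z - ?v z * phi z) = 0"
  proof (rule integral_UNIV_FTC[of ?F])
    show "(?F has_real_derivative ?u z * phi z - ?v z * phi z) (at z)" for z
      by (rule derivative_eq_intros refl DERIV_chain2[OF der] | simp)+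
         (simp add: algebra_simps power2_eq_square)
    show "continuous_on UNIV (\<lambda>z. ?u z * phi z - ?v z * phi z)"
      by (intro continuous_intros) auto
    have le: "norm (?F z) \<le> \<bar>C * (z ^ 1 * phi z)\<bar> + \<bar>C * (z ^ 3 * phi z)\<bar>" for z
    proof -
      have "norm (?F z) \<le> \<bar>z\<bar> * phi z * (C * (1 + z\<^sup>2))"
        unfolding real_norm_def abs_minus_cancel abs_mult by (intro mult_mono growth) auto
      also have "\<dots> = \<bar>C * (z ^ 1 * phi z)\<bar> + \<bar>C * (z ^ 3 * phi z)\<bar>"
      proof -
        have "\<bar>z ^ 3\<bar> = \<bar>z\<bar> * z\<^sup>2" by (simp add: power3_eq_cube power2_eq_square abs_mult)
        then have "\<bar>C * (z ^ 3 * phi z)\<bar> = C * (\<bar>z\<bar> * z\<^sup>2 * phi z)"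
          unfolding abs_mult using C by simp
        moreover have "\<bar>C * (z ^ 1 * phi z)\<bar> = C * (\<bar>z\<bar> * phi z)"
          using C by (simp add: abs_mult)
        ultimately show ?thesis by (simp add: algebra_simps)
      qed
      finally show ?thesis .
    qed
    have lim: "((\<lambda>z. \<bar>C * (z ^ 1 * phi z)\<bar> + \<bar>C * (z ^ 3 * phi z)\<bar>) \<longlongrightarrow> 0) G"
      if "\<And>k. ((\<lambda>z. z ^ k * phi z) \<longlongrightarrow> 0) G" for G
      by (intro tendsto_add_zero tendsto_rabs_zero tendsto_mult_right_zero that)
    show "(?F \<longlongrightarrow> 0) at_bot"
      by (rule Lim_null_comparison[OF always_eventually[OF allI[OF le]] lim]) (rule tendsto_power_phi_at_bot)
    show "(?F \<longlongrightarrow> 0) at_top"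
      by (rule Lim_null_comparison[OF always_eventually[OF allI[OF le]] lim]) (rule tendsto_power_phi_at_top)
  qed (intro Bochner_Integration.integrable_diff intu intv)
  then have "(LINT z|lborel. ?u z * phi z) = (LINT z|lborel. ?v z * phi z)"
    using intu intv by simp
  then show ?thesis
    by (subst (1 2) std_normal_integral) (auto simp: measurable)
qed

text \<open>By independence and Fubini it suffices that the integrals over \<open>X\<close> agree
  for each frozen value of \<open>R\<close>. This lifts a one-dimensional integration by parts to
  one coordinate among many.\<close>

lemma (in prob_space) expectation_indep_eq:
  fixes X R :: "'a \<Rightarrow> real" and u v :: "real \<Rightarrow> real \<Rightarrow> real"
  assumes ind: "indep_var borel X borel R"
    and [measurable]: "case_prod u \<in> borel_measurable borel" "case_prod v \<in> borel_measurable borel"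
    and int: "integrable M (\<lambda>\<omega>. u (X \<omega>) (R \<omega>))" "integrable M (\<lambda>\<omega>. v (X \<omega>) (R \<omega>))"
    and eq: "\<And>r. (LINT x|distr M borel X. u x r) = (LINT x|distr M borel X. v x r)"
  shows "expectation (\<lambda>\<omega>. u (X \<omega>) (R \<omega>)) = expectation (\<lambda>\<omega>. v (X \<omega>) (R \<omega>))"
proof -
  have [measurable]: "X \<in> borel_measurable M" "R \<in> borel_measurable M"
    using ind by (auto dest: indep_var_rv1 indep_var_rv2)
  interpret DX: prob_space "distr M borel X" by (rule prob_space_distr) simp
  interpret DR: prob_space "distr M borel R" by (rule prob_space_distr) simp
  interpret pair_sigma_finite "distr M borel X" "distr M borel R" ..
  have joint: "distr M borel X \<Otimes>\<^sub>M distr M borel R = distr M (borel \<Otimes>\<^sub>M borel) (\<lambda>\<omega>. (X \<omega>, R \<omega>))"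
    using ind by (simp add: indep_var_distribution_eq)
  have iter: "expectation (\<lambda>\<omega>. w (X \<omega>) (R \<omega>)) = (LINT r|distr M borel R. LINT x|distr M borel X. w x r)"
    if [measurable]: "case_prod w \<in> borel_measurable borel"
      and "integrable M (\<lambda>\<omega>. w (X \<omega>) (R \<omega>))" for w :: "real \<Rightarrow> real \<Rightarrow> real"
  proof -
    have [measurable]: "case_prod w \<in> borel_measurable (borel \<Otimes>\<^sub>M borel)"
      using that(1) by (simp add: borel_prod)
    have "integrable (distr M borel X \<Otimes>\<^sub>M distr M borel R) (case_prod w)"
      unfolding joint using that(2) by (subst integrable_distr_eq) auto
    then have "(LINT r|distr M borel R. LINT x|distr M borel X. w x r)
        = integral\<^sup>L (distr M borel X \<Otimes>\<^sub>M distr M borel R) (case_prod w)"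
      by (rule integral_snd)
    also have "\<dots> = expectation (\<lambda>\<omega>. w (X \<omega>) (R \<omega>))"
      unfolding joint by (subst integral_distr) auto
    finally show ?thesis ..
  qed
  show ?thesis using iter[of u] iter[of v] int eq by simp
qed

lemma integrable_mult_L2:
  fixes X Y :: "'a \<Rightarrow> real"
  assumes [measurable]: "X \<in> borel_measurable M" "Y \<in> borel_measurable M"
    and "integrable M (\<lambda>\<omega>. (X \<omega>)\<^sup>2)" "integrable M (\<lambda>\<omega>. (Y \<omega>)\<^sup>2)"
  shows "integrable M (\<lambda>\<omega>. X \<omega> * Y \<omega>)"
proof (rule Bochner_Integration.integrable_bound)
  show "integrable M (\<lambda>\<omega>. (X \<omega>)\<^sup>2 + (Y \<omega>)\<^sup>2)" using assms by simp
  have "\<bar>x * y\<bar> \<le> x\<^sup>2 + y\<^sup>2" for x y :: real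
  proof -
    have "2 * (\<bar>x\<bar> * \<bar>y\<bar>) \<le> x\<^sup>2 + y\<^sup>2"
      using zero_le_power2[of "\<bar>x\<bar> - \<bar>y\<bar>"] by (simp add: power2_diff mult.assoc)
    moreover have "0 \<le> \<bar>x\<bar> * \<bar>y\<bar>" by simp
    ultimately show ?thesis unfolding abs_mult by linarith
  qed
  then show "AE \<omega> in M. norm (X \<omega> * Y \<omega>) \<le> norm ((X \<omega>)\<^sup>2 + (Y \<omega>)\<^sup>2)" by simp
qed simp

section \<open>Second chaos variables over independent standard normals\<close>

locale iid_std_normal = prob_space +
  fixes \<zeta> :: "'i \<Rightarrow> 'a \<Rightarrow> real" and K :: "'i set"
  assumes finite_K: "finite K"
    and indep: "indep_vars (\<lambda>_. borel) \<zeta> K"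
    and distr_std: "\<And>k. k \<in> K \<Longrightarrow> distr M borel (\<zeta> k) = std_normal_distribution"
begin

lemma rv [measurable]: "k \<in> K \<Longrightarrow> \<zeta> k \<in> borel_measurable M"
  using indep by (auto simp: indep_vars_def)

lemma integrable_power_zeta: "k \<in> K \<Longrightarrow> integrable M (\<lambda>\<omega>. \<zeta> k \<omega> ^ n)"
  using integrable_distr_eq[of "\<zeta> k" M borel "\<lambda>x. x ^ n"] integrable_std_normal_distribution_moment[of n]
  by (simp add: distr_std)

lemma expectation_power_zeta:
  "k \<in> K \<Longrightarrow> expectation (\<lambda>\<omega>. \<zeta> k \<omega> ^ (2 * n)) = fact (2 * n) / (2 ^ n * fact n)"
  using integral_distr[of "\<zeta> k" M borel "\<lambda>x. x ^ (2 * n)"] std_normal_distribution_even_moments(1)[of n]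
  by (simp add: distr_std)

text \<open>\<open>x\<^sup>2 - 1\<close> is the second Hermite polynomial: its mean is 0 and its
  second moment under the standard normal law is 3 - 2 + 1 = 2; independence kills the mixed
  terms.\<close>

lemma integrable_square_prod:
  assumes "k \<in> K" "l \<in> K"
  shows "integrable M (\<lambda>\<omega>. ((\<zeta> k \<omega>)\<^sup>2 - 1) * ((\<zeta> l \<omega>)\<^sup>2 - 1))"
    and "expectation (\<lambda>\<omega>. ((\<zeta> k \<omega>)\<^sup>2 - 1) * ((\<zeta> l \<omega>)\<^sup>2 - 1)) = (if k = l then 2 else 0)"
proof -
  have sq: "integrable M (\<lambda>\<omega>. (\<zeta> k \<omega>)\<^sup>2 - 1)" "expectation (\<lambda>\<omega>. (\<zeta> k \<omega>)\<^sup>2 - 1) = 0" if "k \<in> K" for k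
    using integrable_power_zeta[OF that, of 2] expectation_power_zeta[OF that, of 1] by (simp_all add: prob_space)
  have "integrable M (\<lambda>\<omega>. ((\<zeta> k \<omega>)\<^sup>2 - 1) * ((\<zeta> l \<omega>)\<^sup>2 - 1)) \<and>
    expectation (\<lambda>\<omega>. ((\<zeta> k \<omega>)\<^sup>2 - 1) * ((\<zeta> l \<omega>)\<^sup>2 - 1)) = (if k = l then 2 else 0)"
  proof (cases "k = l")
    case True
    have eq: "((\<zeta> k \<omega>)\<^sup>2 - 1) * ((\<zeta> k \<omega>)\<^sup>2 - 1) = \<zeta> k \<omega> ^ 4 - 2 * (\<zeta> k \<omega>)\<^sup>2 + 1" for \<omega>
      by (simp add: algebra_simps power2_eq_square power4_eq_xxxx)
    have "expectation (\<lambda>\<omega>. \<zeta> k \<omega> ^ 4) = 3" "expectation (\<lambda>\<omega>. (\<zeta> k \<omega>)\<^sup>2) = 1"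
      using expectation_power_zeta[OF assms(1), of 2] expectation_power_zeta[OF assms(1), of 1]
      by (simp_all add: fact_numeral)
    then show ?thesis
      using integrable_power_zeta[OF assms(1), of 4] integrable_power_zeta[OF assms(1), of 2]
      unfolding True[symmetric] eq by (simp add: prob_space)
  next
    case False
    have "indep_vars (\<lambda>_. borel) (\<lambda>i \<omega>. (\<zeta> i \<omega>)\<^sup>2 - 1) {k, l}"
      by (rule indep_vars_compose2[OF indep_vars_subset[OF indep]]) (use assms in auto)
    then have "indep_var borel (\<lambda>\<omega>. (\<zeta> k \<omega>)\<^sup>2 - 1) borel (\<lambda>\<omega>. \<Sum>i\<in>{l}. (\<zeta> i \<omega>)\<^sup>2 - 1)"
      using False by (intro indep_vars_sum) auto
    then have ind: "indep_var borel (\<lambda>\<omega>. (\<zeta> k \<omega>)\<^sup>2 - 1) borel (\<lambda>\<omega>. (\<zeta> l \<omega>)\<^sup>2 - 1)"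
      by simp
    show ?thesis
      using indep_var_integrable[OF ind] indep_var_lebesgue_integral[OF ind] sq assms False by auto
  qed
  then show "integrable M (\<lambda>\<omega>. ((\<zeta> k \<omega>)\<^sup>2 - 1) * ((\<zeta> l \<omega>)\<^sup>2 - 1))"
    "expectation (\<lambda>\<omega>. ((\<zeta> k \<omega>)\<^sup>2 - 1) * ((\<zeta> l \<omega>)\<^sup>2 - 1)) = (if k = l then 2 else 0)" by auto
qed

text \<open>The diagonal form of an element of the second Wiener chaos, with the second Hermite
  polynomial of each coordinate.\<close>

definition chaos :: "('i \<Rightarrow> real) \<Rightarrow> 'a \<Rightarrow> real" where
  "chaos a \<omega> = (\<Sum>k\<in>K. a k * ((\<zeta> k \<omega>)\<^sup>2 - 1))"

lemma chaos_measurable [measurable]: "chaos a \<in> borel_measurable M"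
  unfolding chaos_def[abs_def] by measurable

lemma integrable_chaos: "integrable M (chaos a)"
  unfolding chaos_def[abs_def]
  using integrable_power_zeta[of _ 2] by (intro Bochner_Integration.integrable_sum) auto

lemma expectation_chaos: "expectation (chaos a) = 0"
proof -
  have "expectation (\<lambda>\<omega>. a k * ((\<zeta> k \<omega>)\<^sup>2 - 1)) = 0" if "k \<in> K" for k
    using integrable_power_zeta[OF that, of 2] expectation_power_zeta[OF that, of 1] by (simp add: prob_space)
  moreover have "expectation (chaos a) = (\<Sum>k\<in>K. expectation (\<lambda>\<omega>. a k * ((\<zeta> k \<omega>)\<^sup>2 - 1)))"
    unfolding chaos_def[abs_def]
    using integrable_power_zeta[of _ 2] by (intro Bochner_Integration.integral_sum) auto
  ultimately show ?thesis by (metis (no_types, lifting) sum.neutral)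
qed

lemma chaos_second_moment:
  "integrable M (\<lambda>\<omega>. (chaos a \<omega>)\<^sup>2)" "expectation (\<lambda>\<omega>. (chaos a \<omega>)\<^sup>2) = 2 * (\<Sum>k\<in>K. (a k)\<^sup>2)"
proof -
  have eq: "(chaos a \<omega>)\<^sup>2 = (\<Sum>k\<in>K. \<Sum>l\<in>K. a k * a l * (((\<zeta> k \<omega>)\<^sup>2 - 1) * ((\<zeta> l \<omega>)\<^sup>2 - 1)))" for \<omega>
    by (simp only: chaos_def power2_eq_square[of "sum _ _"] sum_product mult_ac)
  show "integrable M (\<lambda>\<omega>. (chaos a \<omega>)\<^sup>2)"
    unfolding eq by (intro Bochner_Integration.integrable_sum integrable_mult_right integrable_square_prod)
  have "expectation (\<lambda>\<omega>. (chaos a \<omega>)\<^sup>2)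
      = (\<Sum>k\<in>K. \<Sum>l\<in>K. a k * a l * (if k = l then 2 else 0))"
    unfolding eq
    by (simp add: integrable_square_prod Bochner_Integration.integral_sum
        Bochner_Integration.integrable_sum integrable_mult_right del: integral_mult_right_zero
        cong: sum.cong)
  also have "\<dots> = (\<Sum>k\<in>K. a k * a k * 2)"
    using finite_K by (intro sum.cong refl) (simp add: if_distrib[of "\<lambda>x. _ * x"] sum.delta' cong: if_cong)
  finally show "expectation (\<lambda>\<omega>. (chaos a \<omega>)\<^sup>2) = 2 * (\<Sum>k\<in>K. (a k)\<^sup>2)"
    by (simp add: power2_eq_square sum_distrib_left mult_ac)
qed

lemma indep_chaos_remainder:
  assumes "k \<in> K"
  shows "indep_var borel (\<zeta> k) borel (\<lambda>\<omega>. \<Sum>l\<in>K - {k}. a l * ((\<zeta> l \<omega>)\<^sup>2 - 1))"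
proof -
  \<comment> \<open>Grouping a family into one variable and the sum of the others requires a single
    family, so coordinate \<open>k\<close> is kept as it is while the others are already turned into
    their chaos terms.\<close>
  let ?Y = "\<lambda>l x. if l = k then x else a l * (x\<^sup>2 - 1)"
  have "indep_vars (\<lambda>_. borel) (\<lambda>l \<omega>. ?Y l (\<zeta> l \<omega>)) K"
    by (rule indep_vars_compose2[OF indep]) auto
  then have "indep_vars (\<lambda>_. borel) (\<lambda>l \<omega>. ?Y l (\<zeta> l \<omega>)) (insert k (K - {k}))"
    unfolding insert_Diff[OF assms] .
  then have "indep_var borel (\<lambda>\<omega>. ?Y k (\<zeta> k \<omega>)) borel (\<lambda>\<omega>. \<Sum>l\<in>K - {k}. ?Y l (\<zeta> l \<omega>))"
    using finite_K by (intro indep_vars_sum) auto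
  moreover have "(\<Sum>l\<in>K - {k}. ?Y l (\<zeta> l \<omega>)) = (\<Sum>l\<in>K - {k}. a l * ((\<zeta> l \<omega>)\<^sup>2 - 1))" for \<omega>
    by (intro sum.cong) auto
  ultimately show ?thesis by simp
qed

lemma chaos_remove:
  "k \<in> K \<Longrightarrow> chaos a \<omega> = a k * ((\<zeta> k \<omega>)\<^sup>2 - 1) + (\<Sum>l\<in>K - {k}. a l * ((\<zeta> l \<omega>)\<^sup>2 - 1))"
  unfolding chaos_def using finite_K by (rule sum.remove)

text \<open>Integrating by parts in each coordinate turns the mean of \<open>F * f F\<close> into
  that of \<open>(1 + G) * f' F\<close>, where \<open>G\<close> is the chaos with weights
  \<open>2 * (a k)\<^sup>2\<close>. So only the mean of \<open>- G * f' F\<close> is left, and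
  \<open>G\<close> has second moment 8 times the sum of the \<open>a k ^ 4\<close>.\<close>

lemma stein_chaos_bound:
  assumes der: "\<And>x. (f has_real_derivative f' x) (at x)" and cont: "continuous_on UNIV f'"
    and bd: "\<And>x. \<bar>f' x\<bar> \<le> B" and var: "2 * (\<Sum>k\<in>K. (a k)\<^sup>2) = 1"
  shows "integrable M (\<lambda>\<omega>. f' (chaos a \<omega>) - chaos a \<omega> * f (chaos a \<omega>))"
    and "\<bar>expectation (\<lambda>\<omega>. f' (chaos a \<omega>) - chaos a \<omega> * f (chaos a \<omega>))\<bar> \<le> B * sqrt (8 * (\<Sum>k\<in>K. a k ^ 4))"
proof -
  let ?F = "chaos a" and ?G = "chaos (\<lambda>k. 2 * (a k)\<^sup>2)"
  have B: "0 \<le> B" using bd[of 0] by linarith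
  have contf: "continuous_on UNIV f"
    using der by (meson DERIV_isCont continuous_at_imp_continuous_on)
  have [measurable]: "f \<in> borel_measurable borel" "f' \<in> borel_measurable borel"
    using contf cont by (auto intro: borel_measurable_continuous_onI)
  have intf2: "integrable M (\<lambda>\<omega>. (f (?F \<omega>))\<^sup>2)"
  proof (rule Bochner_Integration.integrable_bound)
    show "integrable M (\<lambda>\<omega>. 2 * (f 0)\<^sup>2 + 2 * B\<^sup>2 * (?F \<omega>)\<^sup>2)"
      using chaos_second_moment(1) by simp
    have "(f x)\<^sup>2 \<le> 2 * (f 0)\<^sup>2 + 2 * B\<^sup>2 * x\<^sup>2" for x
    proof -
      have "(f x - f 0)\<^sup>2 \<le> (B * x)\<^sup>2"
        using lipschitz_of_bounded_derivative[OF der bd, of x 0] B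
        by (intro abs_le_square_iff[THEN iffD1]) (simp add: abs_mult)
      then show ?thesis
        using zero_le_power2[of "f x - 2 * f 0"] by (simp add: power2_diff power_mult_distrib)
    qed
    then show "AE \<omega> in M. norm ((f (?F \<omega>))\<^sup>2) \<le> norm (2 * (f 0)\<^sup>2 + 2 * B\<^sup>2 * (?F \<omega>)\<^sup>2)" by simp
  qed simp
  have sq2: "integrable M (\<lambda>\<omega>. ((\<zeta> k \<omega>)\<^sup>2 - 1)\<^sup>2)" if "k \<in> K" for k
    using integrable_square_prod(1)[OF that that] by (simp add: power2_eq_square)
  have intu: "integrable M (\<lambda>\<omega>. ((\<zeta> k \<omega>)\<^sup>2 - 1) * f (?F \<omega>))" if "k \<in> K" for k
    using that by (intro integrable_mult_L2 intf2 sq2) measurable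
  have intf': "integrable M (\<lambda>\<omega>. f' (?F \<omega>))"
    using bd by (intro integrable_const_bound[of _ B]) auto
  have intv: "integrable M (\<lambda>\<omega>. 2 * a k * (\<zeta> k \<omega>)\<^sup>2 * f' (?F \<omega>))" if k: "k \<in> K" for k
  proof (rule Bochner_Integration.integrable_bound)
    show "integrable M (\<lambda>\<omega>. 2 * \<bar>a k\<bar> * (\<zeta> k \<omega>)\<^sup>2 * B)"
      using integrable_power_zeta[OF k, of 2] by simp
    show "AE \<omega> in M. norm (2 * a k * (\<zeta> k \<omega>)\<^sup>2 * f' (?F \<omega>)) \<le> norm (2 * \<bar>a k\<bar> * (\<zeta> k \<omega>)\<^sup>2 * B)"
      using bd B by (intro AE_I2) (auto simp: abs_mult intro!: mult_left_mono)
  qed (use k in measurable)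
  have ibp: "expectation (\<lambda>\<omega>. ((\<zeta> k \<omega>)\<^sup>2 - 1) * f (?F \<omega>)) = expectation (\<lambda>\<omega>. 2 * a k * (\<zeta> k \<omega>)\<^sup>2 * f' (?F \<omega>))"
    if k: "k \<in> K" for k
  proof -
    let ?R = "\<lambda>\<omega>. \<Sum>l\<in>K - {k}. a l * ((\<zeta> l \<omega>)\<^sup>2 - 1)"
    have "expectation (\<lambda>\<omega>. ((\<zeta> k \<omega>)\<^sup>2 - 1) * f (a k * ((\<zeta> k \<omega>)\<^sup>2 - 1) + ?R \<omega>))
        = expectation (\<lambda>\<omega>. 2 * a k * (\<zeta> k \<omega>)\<^sup>2 * f' (a k * ((\<zeta> k \<omega>)\<^sup>2 - 1) + ?R \<omega>))"
    proof (rule expectation_indep_eq[OF indep_chaos_remainder[OF k], of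
          "\<lambda>z r. (z\<^sup>2 - 1) * f (a k * (z\<^sup>2 - 1) + r)" "\<lambda>z r. 2 * a k * z\<^sup>2 * f' (a k * (z\<^sup>2 - 1) + r)"])
      show "(\<lambda>(z, r). (z\<^sup>2 - 1) * f (a k * (z\<^sup>2 - 1) + r)) \<in> borel_measurable borel"
        "(\<lambda>(z, r). 2 * a k * z\<^sup>2 * f' (a k * (z\<^sup>2 - 1) + r)) \<in> borel_measurable borel"
        unfolding borel_prod[symmetric] by measurable
      show "integrable M (\<lambda>\<omega>. ((\<zeta> k \<omega>)\<^sup>2 - 1) * f (a k * ((\<zeta> k \<omega>)\<^sup>2 - 1) + ?R \<omega>))"
        using intu[OF k] by (simp only: chaos_remove[OF k])
      show "integrable M (\<lambda>\<omega>. 2 * a k * (\<zeta> k \<omega>)\<^sup>2 * f' (a k * ((\<zeta> k \<omega>)\<^sup>2 - 1) + ?R \<omega>))"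
        using intv[OF k] by (simp only: chaos_remove[OF k])
      show "(LINT z|distr M borel (\<zeta> k). (z\<^sup>2 - 1) * f (a k * (z\<^sup>2 - 1) + r))
          = (LINT z|distr M borel (\<zeta> k). 2 * a k * z\<^sup>2 * f' (a k * (z\<^sup>2 - 1) + r))" for r
        unfolding distr_std[OF k] by (rule std_normal_ibp_square[OF der cont bd])
    qed
    then show ?thesis by (simp only: chaos_remove[OF k])
  qed
  have Ff: "?F \<omega> * f (?F \<omega>) = (\<Sum>k\<in>K. a k * (((\<zeta> k \<omega>)\<^sup>2 - 1) * f (?F \<omega>)))" for \<omega>
    unfolding chaos_def[of a \<omega>] sum_distrib_right by (simp only: mult.assoc)
  have intFf: "integrable M (\<lambda>\<omega>. ?F \<omega> * f (?F \<omega>))"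
    unfolding Ff using intu by (intro Bochner_Integration.integrable_sum integrable_mult_right)
  \<comment> \<open>The unit variance enters here: writing
    \<open>z\<^sup>2 = 1 + (z\<^sup>2 - 1)\<close> in the weighted sum, the constant part is exactly
    1 and cancels the term \<open>f' F\<close> of Stein's equation.\<close>
  have G: "(\<Sum>k\<in>K. a k * (2 * a k * (\<zeta> k \<omega>)\<^sup>2 * f' (?F \<omega>))) = (1 + ?G \<omega>) * f' (?F \<omega>)" for \<omega>
  proof -
    have "(\<Sum>k\<in>K. a k * (2 * a k * (\<zeta> k \<omega>)\<^sup>2)) = 2 * (\<Sum>k\<in>K. (a k)\<^sup>2) + ?G \<omega>"
      by (simp add: chaos_def sum_distrib_left algebra_simps power2_eq_square flip: sum.distrib)
    then have "(\<Sum>k\<in>K. a k * (2 * a k * (\<zeta> k \<omega>)\<^sup>2)) * f' (?F \<omega>) = (1 + ?G \<omega>) * f' (?F \<omega>)"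
      unfolding var by simp
    then show ?thesis
      unfolding sum_distrib_right by (simp only: mult.assoc)
  qed
  have intGf: "integrable M (\<lambda>\<omega>. ?G \<omega> * f' (?F \<omega>))"
    using bd by (intro integrable_mult_L2 chaos_second_moment integrable_const_bound[of _ "B\<^sup>2"])
      (auto simp: abs_le_square_iff[symmetric] B)
  have "expectation (\<lambda>\<omega>. ?F \<omega> * f (?F \<omega>))
      = (\<Sum>k\<in>K. a k * expectation (\<lambda>\<omega>. ((\<zeta> k \<omega>)\<^sup>2 - 1) * f (?F \<omega>)))"
    unfolding Ff using intu by (subst Bochner_Integration.integral_sum) auto
  also have "\<dots> = (\<Sum>k\<in>K. a k * expectation (\<lambda>\<omega>. 2 * a k * (\<zeta> k \<omega>)\<^sup>2 * f' (?F \<omega>)))"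
    using ibp by (intro sum.cong) auto
  also have "\<dots> = expectation (\<lambda>\<omega>. \<Sum>k\<in>K. a k * (2 * a k * (\<zeta> k \<omega>)\<^sup>2 * f' (?F \<omega>)))"
    using intv by (subst Bochner_Integration.integral_sum) auto
  also have "\<dots> = expectation (\<lambda>\<omega>. f' (?F \<omega>)) + expectation (\<lambda>\<omega>. ?G \<omega> * f' (?F \<omega>))"
    unfolding G distrib_right mult_1 using intf' intGf by simp
  finally have eq: "expectation (\<lambda>\<omega>. f' (?F \<omega>) - ?F \<omega> * f (?F \<omega>)) = - expectation (\<lambda>\<omega>. ?G \<omega> * f' (?F \<omega>))"
    using intf' intFf by simp
  have "\<bar>expectation (\<lambda>\<omega>. ?G \<omega> * f' (?F \<omega>))\<bar> \<le> expectation (\<lambda>\<omega>. \<bar>?G \<omega> * f' (?F \<omega>)\<bar>)"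
    by (rule integral_abs_bound)
  also have "\<dots> \<le> expectation (\<lambda>\<omega>. B * \<bar>?G \<omega>\<bar>)"
  proof (rule integral_mono)
    show "integrable M (\<lambda>\<omega>. \<bar>?G \<omega> * f' (?F \<omega>)\<bar>)" by (rule integrable_abs[OF intGf])
    show "integrable M (\<lambda>\<omega>. B * \<bar>?G \<omega>\<bar>)" by (intro integrable_mult_right integrable_abs integrable_chaos)
    show "\<bar>?G \<omega> * f' (?F \<omega>)\<bar> \<le> B * \<bar>?G \<omega>\<bar>" for \<omega>
      unfolding abs_mult mult.commute[of B] by (intro mult_left_mono bd) simp
  qed
  also have "\<dots> = B * expectation (\<lambda>\<omega>. \<bar>?G \<omega>\<bar>)" by simp
  \<comment> \<open>Cauchy-Schwarz, in the form that the variance of \<open>\<bar>G\<bar>\<close> is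
    nonnegative.\<close>
  also have "\<dots> \<le> B * sqrt (expectation (\<lambda>\<omega>. (?G \<omega>)\<^sup>2))"
  proof (intro mult_left_mono B real_le_rsqrt)
    have "0 \<le> variance (\<lambda>\<omega>. \<bar>?G \<omega>\<bar>)" by (rule variance_positive)
    also have "\<dots> = expectation (\<lambda>\<omega>. (?G \<omega>)\<^sup>2) - (expectation (\<lambda>\<omega>. \<bar>?G \<omega>\<bar>))\<^sup>2"
      using integrable_chaos chaos_second_moment(1) by (subst variance_eq) auto
    finally show "(expectation (\<lambda>\<omega>. \<bar>?G \<omega>\<bar>))\<^sup>2 \<le> expectation (\<lambda>\<omega>. (?G \<omega>)\<^sup>2)" by simp
  qed
  also have "expectation (\<lambda>\<omega>. (?G \<omega>)\<^sup>2) = 8 * (\<Sum>k\<in>K. a k ^ 4)"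
    by (simp add: chaos_second_moment power_mult_distrib sum_distrib_left flip: power_mult)
  finally show "\<bar>expectation (\<lambda>\<omega>. f' (?F \<omega>) - ?F \<omega> * f (?F \<omega>))\<bar> \<le> B * sqrt (8 * (\<Sum>k\<in>K. a k ^ 4))"
    unfolding eq by simp
  show "integrable M (\<lambda>\<omega>. f' (?F \<omega>) - ?F \<omega> * f (?F \<omega>))"
    using intf' intFf by simp
qed

end

section \<open>From continuous test functions to Borel sets\<close>

text \<open>The indicator of a compact set is a pointwise limit of continuous functions with values
  in [0,1], so dominated convergence gives the bound there; inner regularity extends it to Borel
  sets.\<close>

lemma tv_bound_from_continuous:
  assumes \<mu>: "real_distribution \<mu>" and \<nu>: "real_distribution \<nu>"
    and bd: "\<And>h. continuous_on UNIV h \<Longrightarrow> (\<And>x. 0 \<le> h x \<and> h x \<le> 1) \<Longrightarrow>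
      \<bar>(LINT x|\<mu>. h x) - (LINT x|\<nu>. h x)\<bar> \<le> b"
    and A: "A \<in> sets borel"
  shows "\<bar>measure \<mu> A - measure \<nu> A\<bar> \<le> b"
proof -
  have compact: "\<bar>measure \<mu> K - measure \<nu> K\<bar> \<le> b" if K: "compact K" for K
  \<comment> \<open>The empty set needs its own case because \<open>infdist\<close> to it is 0 by
    convention, so the cut-off functions would be constantly 1.\<close>
  proof (cases "K = {}")
    case True
    then show ?thesis using bd[of "\<lambda>_. 0"] by simp
  next
    case False
    define h where "h n x = max 0 (1 - real n * infdist x K)" for n x
    have cont: "continuous_on UNIV (h n)" for n
      unfolding h_def[abs_def] by (intro continuous_intros)
    have [measurable]: "h n \<in> borel_measurable borel" for n
      by (rule borel_measurable_continuous_onI[OF cont])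
    have h: "0 \<le> h n x" "h n x \<le> 1" for n x by (auto simp: h_def infdist_nonneg)
    have K': "closed K" "K \<in> sets borel" using K by (auto simp: compact_imp_closed)
    have lim: "(\<lambda>n. h n x) \<longlonglongrightarrow> indicator K x" for x
    proof (cases "x \<in> K")
      case True
      then show ?thesis by (simp add: h_def)
    next
      case out: False
      then have pos: "0 < infdist x K"
        using in_closed_iff_infdist_zero[OF K'(1) False] infdist_nonneg[of x K] by fastforce
      obtain n0 where n0: "1 < real n0 * infdist x K" using reals_Archimedean3[OF pos] by blast
      then have "h n x = 0" if "n \<ge> n0" for n
      proof -
        have "real n0 * infdist x K \<le> real n * infdist x K"
          using that pos by (intro mult_right_mono) auto
        with n0 show ?thesis unfolding h_def by (intro max_absorb1) linarith
      qed
      then have "\<forall>\<^sub>F n in sequentially. h n x = 0"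
        using eventually_sequentially by blast
      then show ?thesis using out by (simp add: tendsto_eventually)
    qed
    have conv: "(\<lambda>n. LINT x|\<rho>. h n x) \<longlonglongrightarrow> measure \<rho> K" if "real_distribution \<rho>" for \<rho>
    proof -
      interpret real_distribution \<rho> by fact
      have "(\<lambda>n. LINT x|\<rho>. h n x) \<longlonglongrightarrow> (LINT x|\<rho>. indicator K x)"
        by (rule integral_dominated_convergence[where w = "\<lambda>_. 1"])
           (use lim h K' in \<open>auto simp: abs_of_nonneg\<close>)
      then show ?thesis using K' by simp
    qed
    have "(\<lambda>n. \<bar>(LINT x|\<mu>. h n x) - (LINT x|\<nu>. h n x)\<bar>) \<longlonglongrightarrow> \<bar>measure \<mu> K - measure \<nu> K\<bar>"
      by (intro tendsto_intros conv \<mu> \<nu>)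
    then show ?thesis
      by (rule LIMSEQ_le_const2) (use bd[OF cont] h in blast)
  qed
  have approx: "\<exists>K\<subseteq>A. compact K \<and> measure \<rho> A - e \<le> measure \<rho> K"
    if \<rho>: "real_distribution \<rho>" and e: "0 < e" for \<rho> e
  proof (cases "measure \<rho> A \<le> e")
    case True
    then show ?thesis by (intro exI[of _ "{}"]) simp
  next
    case False
    interpret real_distribution \<rho> by fact
    have "ennreal (measure \<rho> A - e) < emeasure \<rho> A"
      using e False by (simp add: emeasure_eq_measure ennreal_less_iff)
    also have "emeasure \<rho> A = (SUP K\<in>{K. K \<subseteq> A \<and> compact K}. emeasure \<rho> K)"
      using A by (intro inner_regular) (auto simp: emeasure_eq_measure)
    finally obtain K where "K \<subseteq> A" "compact K" "ennreal (measure \<rho> A - e) < emeasure \<rho> K"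
      by (auto simp: less_SUP_iff)
    then show ?thesis
      using e False by (intro exI[of _ K]) (simp add: emeasure_eq_measure ennreal_less_iff)
  qed
  show ?thesis
  proof (rule field_le_epsilon)
    fix e :: real assume e: "0 < e"
    \<comment> \<open>Each measure has its own approximating compact set; their union lies in
      \<open>A\<close> and serves both.\<close>
    obtain K1 K2 where K: "K1 \<subseteq> A" "compact K1" "measure \<mu> A - e \<le> measure \<mu> K1"
      "K2 \<subseteq> A" "compact K2" "measure \<nu> A - e \<le> measure \<nu> K2"
      using approx[OF \<mu> e] approx[OF \<nu> e] by blast
    interpret \<mu>: real_distribution \<mu> by fact
    interpret \<nu>: real_distribution \<nu> by fact
    have "K1 \<in> sets borel" "K2 \<in> sets borel" using K by (auto simp: compact_imp_closed)
    then have "measure \<mu> K1 \<le> measure \<mu> (K1 \<union> K2)" "measure \<nu> K2 \<le> measure \<nu> (K1 \<union> K2)"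
      "measure \<mu> (K1 \<union> K2) \<le> measure \<mu> A" "measure \<nu> (K1 \<union> K2) \<le> measure \<nu> A"
      using K A by (auto intro!: \<mu>.finite_measure_mono \<nu>.finite_measure_mono)
    moreover have "\<bar>measure \<mu> (K1 \<union> K2) - measure \<nu> (K1 \<union> K2)\<bar> \<le> b"
      using K by (intro compact) auto
    ultimately show "\<bar>measure \<mu> A - measure \<nu> A\<bar> \<le> b + e" using K by linarith
  qed
qed

lemma kolmogorov_le_total_variation: "kolmogorov_dist \<mu> \<nu> \<le> total_variation_dist \<mu> \<nu>"
  unfolding kolmogorov_dist_def total_variation_dist_def
  by (intro SUP_least SUP_upper2[of "{.._}"]) auto

lemma integrable_abs_le_affine:
  assumes "prob_space M" "integrable M (X :: 'a \<Rightarrow> real)" "h \<in> borel_measurable borel" "\<And>x. \<bar>h x\<bar> \<le> c + \<bar>x\<bar>"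
  shows "integrable M (\<lambda>\<omega>. h (X \<omega>))"
proof -
  interpret prob_space M by fact
  show ?thesis
  proof (rule Bochner_Integration.integrable_bound)
    show "integrable M (\<lambda>\<omega>. c + \<bar>X \<omega>\<bar>)" using assms by simp
    show "AE \<omega> in M. norm (h (X \<omega>)) \<le> norm (c + \<bar>X \<omega>\<bar>)"
      using assms(4) by (intro AE_I2) (smt (verit) real_norm_def)
  qed (use assms in measurable)
qed

section \<open>Distances from a second chaos variable to the normal law\<close>

context iid_std_normal
begin

text \<open>The factor 3 is the bound on the derivative in Stein's equation. Affine growth makes
  \<open>h\<close> integrable under both laws, so the means can be subtracted.\<close>

lemma chaos_expectation_bound:
  assumes var: "2 * (\<Sum>k\<in>K. (a k)\<^sup>2) = 1" and cont: "continuous_on UNIV h"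
    and growth: "\<And>x. \<bar>h x\<bar> \<le> c + \<bar>x\<bar>"
    and m: "m = (LINT x|std_normal_distribution. h x)"
    and h: "(\<forall>y. \<bar>h y - m\<bar> \<le> 1) \<or> (\<forall>y z. \<bar>h y - h z\<bar> \<le> \<bar>y - z\<bar>) \<and> (\<forall>y. \<bar>h y - m\<bar> \<le> \<bar>y\<bar> + 1)"
  shows "\<bar>expectation (\<lambda>\<omega>. h (chaos a \<omega>)) - m\<bar> \<le> 3 * sqrt (8 * (\<Sum>k\<in>K. a k ^ 4))"
proof -
  have hm [measurable]: "h \<in> borel_measurable borel" by (rule borel_measurable_continuous_onI[OF cont])
  interpret N: real_distribution std_normal_distribution by (rule real_dist_normal_dist)
  have "integrable std_normal_distribution (\<lambda>x. h x)"
    by (rule integrable_abs_le_affine[OF N.prob_space_axioms _ hm growth])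
      (use integrable_std_normal_distribution_moment[of 1] in simp)
  then have int: "integrable lborel (\<lambda>x. h x * phi x)" using hm by (simp add: std_normal_integrable_iff)
  obtain f f' where f: "\<And>x. (f has_real_derivative f' x) (at x)" "continuous_on UNIV f'"
    "\<And>x. \<bar>f' x\<bar> \<le> 3" "\<And>x. f' x - x * f x = h x - m"
    using stein_solution_exists[OF cont int _ h] m std_normal_integral[OF hm] by metis
  have "integrable M (\<lambda>\<omega>. h (chaos a \<omega>))"
    by (rule integrable_abs_le_affine[OF prob_space_axioms integrable_chaos hm growth])
  then have "expectation (\<lambda>\<omega>. h (chaos a \<omega>)) - m = expectation (\<lambda>\<omega>. h (chaos a \<omega>) - m)"
    by (simp add: prob_space)
  then show ?thesis
    using stein_chaos_bound(2)[OF f(1,2,3) var] by (simp add: f(4))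
qed

lemma chaos_real_distribution: "real_distribution (distr M borel (chaos a))"
  by (rule real_distribution_distr) measurable

text \<open>A test function with values in [0,1] has its mean in [0,1] too, so it falls under the
  bounded alternative.\<close>

lemma chaos_total_variation:
  assumes var: "2 * (\<Sum>k\<in>K. (a k)\<^sup>2) = 1"
  shows "total_variation_dist (distr M borel (chaos a)) std_normal_distribution
    \<le> ennreal (3 * sqrt (8 * (\<Sum>k\<in>K. a k ^ 4)))"
  unfolding total_variation_dist_def
proof (intro SUP_least ennreal_leI tv_bound_from_continuous chaos_real_distribution real_dist_normal_dist)
  interpret N: real_distribution std_normal_distribution by (rule real_dist_normal_dist)
  fix h :: "real \<Rightarrow> real" assume cont: "continuous_on UNIV h" and h: "\<And>x. 0 \<le> h x \<and> h x \<le> 1"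
  have hm [measurable]: "h \<in> borel_measurable borel" by (rule borel_measurable_continuous_onI[OF cont])
  let ?m = "LINT x|std_normal_distribution. h x"
  have "integrable std_normal_distribution h"
    using h by (intro N.integrable_const_bound[of _ 1]) (auto simp: abs_of_nonneg)
  then have "?m \<le> (LINT x|std_normal_distribution. 1)"
    using h by (intro integral_mono) auto
  then have m: "0 \<le> ?m" "?m \<le> 1"
    using h N.prob_space by auto
  have "\<bar>expectation (\<lambda>\<omega>. h (chaos a \<omega>)) - ?m\<bar> \<le> 3 * sqrt (8 * (\<Sum>k\<in>K. a k ^ 4))"
  proof (rule chaos_expectation_bound[OF var cont _ refl, of 1])
    show "\<bar>h x\<bar> \<le> 1 + \<bar>x\<bar>" for x using h[of x] by linarith
    have "\<bar>h y - ?m\<bar> \<le> 1" for y using h[of y] m by linarith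
    then show "(\<forall>y. \<bar>h y - ?m\<bar> \<le> 1) \<or> (\<forall>y z. \<bar>h y - h z\<bar> \<le> \<bar>y - z\<bar>) \<and> (\<forall>y. \<bar>h y - ?m\<bar> \<le> \<bar>y\<bar> + 1)"
      by blast
  qed
  then show "\<bar>(LINT x|distr M borel (chaos a). h x) - ?m\<bar> \<le> 3 * sqrt (8 * (\<Sum>k\<in>K. a k ^ 4))"
    by (subst integral_distr) auto
qed auto

text \<open>For a 1-Lipschitz function the distance of \<open>h y\<close> from its Gaussian mean is
  at most \<open>\<bar>y\<bar>\<close> plus the first absolute moment. That moment is at most 1,
  since \<open>\<bar>x\<bar> \<le> (1 + x\<^sup>2) / 2\<close>.\<close>

lemma chaos_wasserstein:
  assumes var: "2 * (\<Sum>k\<in>K. (a k)\<^sup>2) = 1"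
  shows "wasserstein_dist (distr M borel (chaos a)) std_normal_distribution
    \<le> ennreal (3 * sqrt (8 * (\<Sum>k\<in>K. a k ^ 4)))"
  unfolding wasserstein_dist_def
proof (intro SUP_least ennreal_leI)
  interpret N: real_distribution std_normal_distribution by (rule real_dist_normal_dist)
  fix h :: "real \<Rightarrow> real" assume "h \<in> {h. 1-lipschitz_on UNIV h}"
  then have lip': "1-lipschitz_on UNIV h" by simp
  then have lip: "\<bar>h y - h z\<bar> \<le> \<bar>y - z\<bar>" for y z
    by (auto simp: lipschitz_on_def dist_real_def)
  have cont: "continuous_on UNIV h" by (rule lipschitz_on_continuous_on[OF lip'])
  have hm [measurable]: "h \<in> borel_measurable borel" by (rule borel_measurable_continuous_onI[OF cont])
  let ?m = "LINT x|std_normal_distribution. h x"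
  have growth: "\<bar>h x\<bar> \<le> \<bar>h 0\<bar> + \<bar>x\<bar>" for x using lip[of x 0] by linarith
  have id: "integrable std_normal_distribution (\<lambda>x. x)" "integrable std_normal_distribution (\<lambda>x. x\<^sup>2)"
    using integrable_std_normal_distribution_moment[of 1] integrable_std_normal_distribution_moment[of 2] by auto
  have inth: "integrable std_normal_distribution (\<lambda>x. h x)"
    by (rule integrable_abs_le_affine[OF N.prob_space_axioms id(1) hm growth])
  have second: "(LINT x|std_normal_distribution. x\<^sup>2) = 1"
    using std_normal_distribution_even_moments(1)[of 1] by simp
  have abs1: "(LINT x|std_normal_distribution. \<bar>x\<bar>) \<le> 1"
  proof -
    have "(LINT x|std_normal_distribution. \<bar>x\<bar>) \<le> (LINT x|std_normal_distribution. (1 + x\<^sup>2) / 2)"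
    proof (rule integral_mono)
      show "\<bar>x\<bar> \<le> (1 + x\<^sup>2) / 2" for x :: real
        using zero_le_power2[of "\<bar>x\<bar> - 1"] by (simp add: power2_diff)
    qed (use id in auto)
    also have "\<dots> = 1" using id N.prob_space second by simp
    finally show ?thesis .
  qed
  have "\<bar>h y - ?m\<bar> \<le> \<bar>y\<bar> + 1" for y
  proof -
    have "h y - ?m = (LINT x|std_normal_distribution. h y - h x)"
      using inth N.prob_space by simp
    also have "\<bar>\<dots>\<bar> \<le> (LINT x|std_normal_distribution. \<bar>h y - h x\<bar>)" by (rule integral_abs_bound)
    also have "\<dots> \<le> (LINT x|std_normal_distribution. \<bar>y\<bar> + \<bar>x\<bar>)"
    proof (rule integral_mono)
      show "\<bar>h y - h x\<bar> \<le> \<bar>y\<bar> + \<bar>x\<bar>" for x using lip[of y x] by linarith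
    qed (use id inth in auto)
    also have "\<dots> \<le> \<bar>y\<bar> + 1" using id abs1 N.prob_space by simp
    finally show ?thesis .
  qed
  then have "\<bar>expectation (\<lambda>\<omega>. h (chaos a \<omega>)) - ?m\<bar> \<le> 3 * sqrt (8 * (\<Sum>k\<in>K. a k ^ 4))"
    using lip by (intro chaos_expectation_bound[OF var cont growth refl]) blast
  then show "\<bar>(LINT x|distr M borel (chaos a). h x) - ?m\<bar> \<le> 3 * sqrt (8 * (\<Sum>k\<in>K. a k ^ 4))"
    by (subst integral_distr) auto
qed

end

section \<open>Gaussian spaces\<close>

text \<open>Increments are kept as finite combinations of Wiener integrals rather than as the
  integral of one combined function, since linearity of the integral holds only almost
  surely.\<close>

definition gaussian_span :: "'i set \<Rightarrow> ('i \<Rightarrow> 'a \<Rightarrow> real) \<Rightarrow> ('a \<Rightarrow> real) set" where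
  "gaussian_span I X = {Y. \<exists>J c. finite J \<and> J \<subseteq> I \<and> Y = (\<lambda>\<omega>. \<Sum>i\<in>J. c i * X i \<omega>)}"

lemma gaussian_span_base: "i \<in> I \<Longrightarrow> X i \<in> gaussian_span I X"
  unfolding gaussian_span_def
  by (rule CollectI, rule exI[of _ "{i}"], rule exI[of _ "\<lambda>_. 1"]) simp

lemma gaussian_span_scale:
  assumes "Y \<in> gaussian_span I X"
  shows "(\<lambda>\<omega>. a * Y \<omega>) \<in> gaussian_span I X"
proof -
  obtain J c where "finite J" "J \<subseteq> I" "Y = (\<lambda>\<omega>. \<Sum>i\<in>J. c i * X i \<omega>)"
    using assms by (auto simp: gaussian_span_def)
  then show ?thesis
    unfolding gaussian_span_def
    by (intro CollectI exI[of _ J] exI[of _ "\<lambda>i. a * c i"]) (simp add: sum_distrib_left mult.assoc)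
qed

lemma gaussian_span_add:
  assumes "Y \<in> gaussian_span I X" "Z \<in> gaussian_span I X"
  shows "(\<lambda>\<omega>. Y \<omega> + Z \<omega>) \<in> gaussian_span I X"
proof -
  obtain J c where J: "finite J" "J \<subseteq> I" "Y = (\<lambda>\<omega>. \<Sum>i\<in>J. c i * X i \<omega>)"
    using assms by (auto simp: gaussian_span_def)
  obtain L d where L: "finite L" "L \<subseteq> I" "Z = (\<lambda>\<omega>. \<Sum>i\<in>L. d i * X i \<omega>)"
    using assms by (auto simp: gaussian_span_def)
  have "(\<Sum>i\<in>J. c i * X i \<omega>) = (\<Sum>i\<in>J \<union> L. (if i \<in> J then c i else 0) * X i \<omega>)" for \<omega>
    using J L by (intro sum.mono_neutral_cong_left) auto
  moreover have "(\<Sum>i\<in>L. d i * X i \<omega>) = (\<Sum>i\<in>J \<union> L. (if i \<in> L then d i else 0) * X i \<omega>)" for \<omega>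
    using J L by (intro sum.mono_neutral_cong_left) auto
  ultimately have "(\<lambda>\<omega>. Y \<omega> + Z \<omega>) = (\<lambda>\<omega>. \<Sum>i\<in>J \<union> L.
      ((if i \<in> J then c i else 0) + (if i \<in> L then d i else 0)) * X i \<omega>)"
    unfolding J L distrib_right sum.distrib by simp
  then show ?thesis
    unfolding gaussian_span_def using J L
    by (intro CollectI exI[of _ "J \<union> L"] exI conjI) auto
qed

lemma gaussian_span_diff:
  assumes "Y \<in> gaussian_span I X" "Z \<in> gaussian_span I X"
  shows "(\<lambda>\<omega>. Y \<omega> - Z \<omega>) \<in> gaussian_span I X"
  using gaussian_span_add[OF assms(1) gaussian_span_scale[OF assms(2), of "-1"]] by simp

lemma gaussian_span_sum:
  assumes "finite K" "\<And>k. k \<in> K \<Longrightarrow> Y k \<in> gaussian_span I X"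
  shows "(\<lambda>\<omega>. \<Sum>k\<in>K. Y k \<omega>) \<in> gaussian_span I X"
  using assms
proof (induction K rule: finite_induct)
  case empty
  then show ?case unfolding gaussian_span_def by (intro CollectI exI[of _ "{}"]) simp
next
  case (insert k K)
  then show ?case by (simp add: gaussian_span_add)
qed

lemma centred_gaussian_span:
  "jointly_centred_gaussian P I X \<Longrightarrow> Y \<in> gaussian_span I X \<Longrightarrow> centred_gaussian P Y"
  by (auto simp: jointly_centred_gaussian_def gaussian_span_def)

context prob_space
begin

text \<open>Writing the characteristic function through the second moment treats the degenerate and
  the nondegenerate law uniformly.\<close>

lemma centred_gaussian_char:
  assumes "centred_gaussian M X"
  shows "integrable M (\<lambda>\<omega>. (X \<omega>)\<^sup>2)"
    and "expectation (\<lambda>\<omega>. iexp (X \<omega>)) = exp (- expectation (\<lambda>\<omega>. (X \<omega>)\<^sup>2) / 2)"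
proof -
  have [measurable]: "X \<in> borel_measurable M" using assms by (simp add: centred_gaussian_def)
  have "integrable M (\<lambda>\<omega>. (X \<omega>)\<^sup>2) \<and>
    expectation (\<lambda>\<omega>. iexp (X \<omega>)) = exp (- expectation (\<lambda>\<omega>. (X \<omega>)\<^sup>2) / 2)"
  proof (cases "AE \<omega> in M. X \<omega> = 0")
    case True
    have "integrable M (\<lambda>\<omega>. (X \<omega>)\<^sup>2) \<longleftrightarrow> integrable M (\<lambda>\<omega>. 0 :: real)"
      using True by (intro integrable_cong_AE) auto
    moreover have "expectation (\<lambda>\<omega>. (X \<omega>)\<^sup>2) = expectation (\<lambda>\<omega>. 0 :: real)"
      using True by (intro integral_cong_AE) auto
    moreover have "expectation (\<lambda>\<omega>. iexp (X \<omega>)) = expectation (\<lambda>\<omega>. 1 :: complex)"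
      using True by (intro integral_cong_AE) auto
    ultimately show ?thesis by (simp add: prob_space)
  next
    case False
    then obtain \<sigma> where \<sigma>: "0 < \<sigma>" and D: "distributed M lborel X (\<lambda>x. ennreal (normal_density 0 \<sigma> x))"
      using assms by (auto simp: centred_gaussian_def)
    define Y where "Y \<omega> = X \<omega> / \<sigma>" for \<omega>
    have X: "X \<omega> = \<sigma> * Y \<omega>" for \<omega> using \<sigma> by (simp add: Y_def)
    have [measurable]: "Y \<in> borel_measurable M" unfolding Y_def[abs_def] by simp
    have "distributed M lborel Y (\<lambda>x. ennreal (phi x))"
      using D normal_standard_normal_convert[OF \<sigma>, of X 0] by (simp add: Y_def[abs_def])
    then have "distr M lborel Y = std_normal_distribution"
      by (rule distributed_distr_eq_density)
    then have dY: "distr M borel Y = std_normal_distribution"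
      by (simp cong: distr_cong)
    have sq: "integrable M (\<lambda>\<omega>. (Y \<omega>)\<^sup>2)" "expectation (\<lambda>\<omega>. (Y \<omega>)\<^sup>2) = 1"
      using integrable_distr_eq[of Y M borel "\<lambda>x. x\<^sup>2"] integral_distr[of Y M borel "\<lambda>x. x\<^sup>2"]
        integrable_std_normal_distribution_moment[of 2] std_normal_distribution_even_moments(1)[of 1]
      by (simp_all add: dY)
    have "expectation (\<lambda>\<omega>. iexp (\<sigma> * Y \<omega>)) = char (distr M borel Y) \<sigma>"
      unfolding char_def by (subst integral_distr) auto
    also have "\<dots> = exp (- \<sigma>\<^sup>2 / 2)"
      unfolding dY by (simp add: char_std_normal_distribution)
    finally show ?thesis
      using sq unfolding X by (simp add: power_mult_distrib)
  qed
  then show "integrable M (\<lambda>\<omega>. (X \<omega>)\<^sup>2)"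
    "expectation (\<lambda>\<omega>. iexp (X \<omega>)) = exp (- expectation (\<lambda>\<omega>. (X \<omega>)\<^sup>2) / 2)" by auto
qed

lemma integrable_gaussian_span_mult:
  assumes "jointly_centred_gaussian M I X" "Y \<in> gaussian_span I X" "Z \<in> gaussian_span I X"
  shows "integrable M (\<lambda>\<omega>. Y \<omega> * Z \<omega>)"
  using centred_gaussian_span[OF assms(1,2)] centred_gaussian_span[OF assms(1,3)]
  by (intro integrable_mult_L2 centred_gaussian_char) (auto simp: centred_gaussian_def)

lemma expectation_sum_mult_sum:
  fixes Y :: "'b \<Rightarrow> 'a \<Rightarrow> real" and Z :: "'c \<Rightarrow> 'a \<Rightarrow> real"
  assumes "\<And>p q. p \<in> A \<Longrightarrow> q \<in> B \<Longrightarrow> integrable M (\<lambda>\<omega>. Y p \<omega> * Z q \<omega>)"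
  shows "expectation (\<lambda>\<omega>. (\<Sum>p\<in>A. a p * Y p \<omega>) * (\<Sum>q\<in>B. b q * Z q \<omega>))
    = (\<Sum>p\<in>A. \<Sum>q\<in>B. a p * b q * expectation (\<lambda>\<omega>. Y p \<omega> * Z q \<omega>))"
proof -
  have eq: "(\<Sum>p\<in>A. a p * Y p \<omega>) * (\<Sum>q\<in>B. b q * Z q \<omega>)
      = (\<Sum>p\<in>A. \<Sum>q\<in>B. a p * b q * (Y p \<omega> * Z q \<omega>))" for \<omega>
    by (simp only: sum_product mult_ac)
  have int: "integrable M (\<lambda>\<omega>. a p * b q * (Y p \<omega> * Z q \<omega>))" if "p \<in> A" "q \<in> B" for p q
    using assms[OF that] by simp
  have "expectation (\<lambda>\<omega>. \<Sum>p\<in>A. \<Sum>q\<in>B. a p * b q * (Y p \<omega> * Z q \<omega>))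
      = (\<Sum>p\<in>A. expectation (\<lambda>\<omega>. \<Sum>q\<in>B. a p * b q * (Y p \<omega> * Z q \<omega>)))"
    by (intro Bochner_Integration.integral_sum Bochner_Integration.integrable_sum int)
  also have "\<dots> = (\<Sum>p\<in>A. \<Sum>q\<in>B. expectation (\<lambda>\<omega>. a p * b q * (Y p \<omega> * Z q \<omega>)))"
    by (intro sum.cong refl Bochner_Integration.integral_sum int)
  finally show ?thesis unfolding eq by simp
qed

text \<open>Each combination of the variables is again in the span, hence centred Gaussian, and
  orthonormality gives it the sum of the \<open>(c k)\<^sup>2\<close> as variance. So the joint
  characteristic function factorises, and uncorrelated becomes independent.\<close>

lemma orthonormal_gaussian_span_iid:
  fixes \<zeta> :: "'k \<Rightarrow> 'a \<Rightarrow> real"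
  assumes X: "jointly_centred_gaussian M I X" and K: "finite K"
    and \<zeta>: "\<And>k. k \<in> K \<Longrightarrow> \<zeta> k \<in> gaussian_span I X"
    and cov: "\<And>k l. k \<in> K \<Longrightarrow> l \<in> K \<Longrightarrow> expectation (\<lambda>\<omega>. \<zeta> k \<omega> * \<zeta> l \<omega>) = (if k = l then 1 else 0)"
  shows "iid_std_normal M \<zeta> K"
proof -
  have meas: "\<zeta> k \<in> borel_measurable M" if "k \<in> K" for k
    using centred_gaussian_span[OF X \<zeta>[OF that]] by (simp add: centred_gaussian_def)
  have char: "expectation (\<lambda>\<omega>. iexp (\<Sum>k\<in>K. c k * \<zeta> k \<omega>)) = (\<Prod>k\<in>K. char std_normal_distribution (c k))" for c
  proof -
    have span: "(\<lambda>\<omega>. \<Sum>k\<in>K. c k * \<zeta> k \<omega>) \<in> gaussian_span I X"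
      using \<zeta> by (intro gaussian_span_sum K gaussian_span_scale)
    have "expectation (\<lambda>\<omega>. (\<Sum>k\<in>K. c k * \<zeta> k \<omega>)\<^sup>2)
        = (\<Sum>k\<in>K. \<Sum>l\<in>K. c k * c l * expectation (\<lambda>\<omega>. \<zeta> k \<omega> * \<zeta> l \<omega>))"
      unfolding power2_eq_square
      by (intro expectation_sum_mult_sum integrable_gaussian_span_mult[OF X] \<zeta>)
    also have "\<dots> = (\<Sum>k\<in>K. \<Sum>l\<in>K. if k = l then c k * c k else 0)"
      by (intro sum.cong refl) (auto simp: cov)
    also have "\<dots> = (\<Sum>k\<in>K. (c k)\<^sup>2)"
      using K by (simp add: power2_eq_square)
    finally have "expectation (\<lambda>\<omega>. iexp (\<Sum>k\<in>K. c k * \<zeta> k \<omega>)) = exp (- (\<Sum>k\<in>K. (c k)\<^sup>2) / 2)"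
      using centred_gaussian_char(2)[OF centred_gaussian_span[OF X span]] by simp
    also have "- (\<Sum>k\<in>K. (c k)\<^sup>2) / 2 = (\<Sum>k\<in>K. - (c k)\<^sup>2 / 2)"
      by (simp add: sum_divide_distrib sum_negf)
    finally show ?thesis
      by (simp add: char_std_normal_distribution exp_sum K)
  qed
  show ?thesis
    using char_imp_indep_std_normal[OF K meas char] K
    by (intro iid_std_normal.intro iid_std_normal_axioms.intro prob_space_axioms) auto
qed

end

section \<open>Covariance of the mild solution\<close>

definition wave_kernel :: "real \<Rightarrow> real \<Rightarrow> real \<times> real \<Rightarrow> real" where
  "wave_kernel t x = (\<lambda>(r, y). indicator {0..t} r * G1 (t - r) (x - y))"

text \<open>The cone condition already forces \<open>r < t\<close>, so only the lower bound on
  \<open>r\<close> has to be kept.\<close>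

lemma wave_kernel_eq: "wave_kernel t x (r, y) = (if 0 \<le> r \<and> \<bar>x - y\<bar> < t - r then 1 / 2 else 0)"
  by (auto simp: wave_kernel_def G1_def indicator_def)

lemma wave_kernel_measurable [measurable]: "wave_kernel t x \<in> borel_measurable borel"
proof -
  have "(\<lambda>p. if 0 \<le> fst p \<and> \<bar>x - snd p\<bar> < t - fst p then 1 / 2 else 0 :: real)
      \<in> borel_measurable (borel \<Otimes>\<^sub>M borel)"
    by measurable
  moreover have "wave_kernel t x = (\<lambda>p. if 0 \<le> fst p \<and> \<bar>x - snd p\<bar> < t - fst p then 1 / 2 else 0)"
    by (auto simp: fun_eq_iff wave_kernel_eq)
  ultimately show ?thesis by (simp add: borel_prod)
qed

text \<open>Backward cones over one space point are nested; on the smaller one the product is 1/4,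
  half of the kernel.\<close>

lemma wave_kernel_mult_same: "wave_kernel t x p * wave_kernel s x p = wave_kernel (min t s) x p / 2"
  by (cases p) (auto simp: wave_kernel_eq)

text \<open>A common point at time \<open>r \<ge> 0\<close> would force
  \<open>\<bar>x - x'\<bar> < t + s - 2 * r\<close>, by the triangle inequality.\<close>

lemma wave_kernel_mult_disjoint:
  assumes "t + s \<le> \<bar>x - x'\<bar>"
  shows "wave_kernel t x p * wave_kernel s x' p = 0"
  using assms by (cases p) (auto simp: wave_kernel_eq)

text \<open>At time \<open>r\<close> the cone has width \<open>2 * (t - r)\<close>, so half of it is
  integrated over [0,t].\<close>

lemma nn_integral_wave_kernel:
  assumes "0 \<le> t"
  shows "(\<integral>\<^sup>+p. ennreal (wave_kernel t x p) \<partial>lborel) = ennreal (t\<^sup>2 / 2)"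
proof -
  have m [measurable]: "wave_kernel t x \<in> borel_measurable (borel \<Otimes>\<^sub>M borel)"
    using wave_kernel_measurable by (simp add: borel_prod)
  have "(\<integral>\<^sup>+p. ennreal (wave_kernel t x p) \<partial>lborel)
      = (\<integral>\<^sup>+p. ennreal (wave_kernel t x p) \<partial>(lborel \<Otimes>\<^sub>M lborel))"
    by (simp add: lborel_prod)
  also have "\<dots> = (\<integral>\<^sup>+r. \<integral>\<^sup>+y. ennreal (wave_kernel t x (r, y)) \<partial>lborel \<partial>lborel)"
    by (rule lborel.nn_integral_fst[symmetric]) measurable
  also have "\<dots> = (\<integral>\<^sup>+r. ennreal (t - r) * indicator {0..t} r \<partial>lborel)"
  proof (rule nn_integral_cong)
    fix r
    show "(\<integral>\<^sup>+y. ennreal (wave_kernel t x (r, y)) \<partial>lborel) = ennreal (t - r) * indicator {0..t} r"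
    proof (cases "r \<in> {0..t}")
      case True
      have "ennreal (wave_kernel t x (r, y)) = ennreal (1 / 2) * indicator {x - (t - r)<..<x + (t - r)} y" for y
        using True by (auto simp: wave_kernel_eq indicator_def)
      then have "(\<integral>\<^sup>+y. ennreal (wave_kernel t x (r, y)) \<partial>lborel)
          = ennreal (1 / 2) * emeasure lborel {x - (t - r)<..<x + (t - r)}"
        by (simp add: nn_integral_cmult_indicator)
      also have "\<dots> = ennreal (1 / 2) * ennreal (2 * (t - r))" using True by simp
      also have "\<dots> = ennreal (t - r)"
        using True by (subst ennreal_mult[symmetric]) auto
      finally show ?thesis using True by simp
    next
      case False
      then have "wave_kernel t x (r, y) = 0" for y by (auto simp: wave_kernel_eq)
      then show ?thesis using False by simp
    qed
  qed
  also have "\<dots> = ennreal ((t * t - t\<^sup>2 / 2) - (t * 0 - 0\<^sup>2 / 2))"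
    by (rule nn_integral_FTC_Icc) (use assms in \<open>auto intro!: derivative_eq_intros\<close>)
  finally show ?thesis by (simp add: power2_eq_square)
qed

lemma has_bochner_integral_wave_kernel:
  assumes "0 \<le> t"
  shows "has_bochner_integral time_space (wave_kernel t x) (t\<^sup>2 / 2)"
proof -
  have nn: "0 \<le> wave_kernel t x p" for p by (cases p) (simp add: wave_kernel_eq)
  have "has_bochner_integral lborel (wave_kernel t x) (t\<^sup>2 / 2)"
    using nn nn_integral_wave_kernel[OF assms, of x] by (intro has_bochner_integral_nn_integral) auto
  moreover have eq: "(\<lambda>p. indicator ({0..} \<times> UNIV) p *\<^sub>R wave_kernel t x p) = wave_kernel t x"
    by (auto simp: fun_eq_iff wave_kernel_eq indicator_def)
  have S: "({0..} \<times> UNIV) \<inter> space lborel \<in> sets (lborel :: (real \<times> real) measure)"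
    by (simp add: closed_Times)
  ultimately show ?thesis
    unfolding time_space_def has_bochner_integral_iff
      integrable_restrict_space[OF S] integral_restrict_space[OF S] eq by simp
qed

lemma wave_kernel_L2: "0 \<le> t \<Longrightarrow> wave_kernel t x \<in> L2_time_space"
proof -
  assume t: "0 \<le> t"
  have "wave_kernel t x \<in> borel_measurable time_space"
    unfolding time_space_def by (intro measurable_restrict_space1) simp
  moreover have "integrable time_space (\<lambda>p. (wave_kernel t x p)\<^sup>2)"
    unfolding power2_eq_square wave_kernel_mult_same min.idem
    using has_bochner_integral_wave_kernel[OF t, of x] by (simp add: has_bochner_integral_iff)
  ultimately show ?thesis by (simp add: L2_time_space_def)
qed

lemma mild_solution_kernel: "mild_solution W t x = W (wave_kernel t x)"
  by (simp add: mild_solution_def wave_kernel_def)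

text \<open>At a fixed space point the covariance is that of Brownian motion run with the clock
  \<open>t\<^sup>2 / 4\<close>, which is why time increments turn out to be independent.\<close>

lemma mild_solution_covariance:
  assumes W: "space_time_white_noise P W" and t: "0 \<le> t" "0 \<le> s"
  shows "prob_space.expectation P (\<lambda>\<omega>. mild_solution W t x \<omega> * mild_solution W s x \<omega>) = (min t s)\<^sup>2 / 4"
    and "t + s \<le> \<bar>x - x'\<bar> \<Longrightarrow>
      prob_space.expectation P (\<lambda>\<omega>. mild_solution W t x \<omega> * mild_solution W s x' \<omega>) = 0"
proof -
  have cov: "prob_space.expectation P (\<lambda>\<omega>. mild_solution W t x \<omega> * mild_solution W s x' \<omega>)
      = (LINT p|time_space. wave_kernel t x p * wave_kernel s x' p)" for x'
    using W wave_kernel_L2 t by (simp add: space_time_white_noise_def mild_solution_kernel)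
  show "prob_space.expectation P (\<lambda>\<omega>. mild_solution W t x \<omega> * mild_solution W s x \<omega>) = (min t s)\<^sup>2 / 4"
    unfolding cov wave_kernel_mult_same
    using has_bochner_integral_wave_kernel[of "min t s" x] t by (simp add: has_bochner_integral_iff)
  show "prob_space.expectation P (\<lambda>\<omega>. mild_solution W t x \<omega> * mild_solution W s x' \<omega>) = 0"
    if "t + s \<le> \<bar>x - x'\<bar>"
    unfolding cov wave_kernel_mult_disjoint[OF that] by simp
qed

section \<open>The discrete sine transform\<close>

text \<open>Multiplication by \<open>2 * sin (\<theta> / 2)\<close> makes the sum telescope;
  \<open>m < 2 * n\<close> keeps \<open>\<theta> / 2\<close> below \<open>pi\<close>, so this factor
  is positive and can be cancelled.\<close>

lemma sum_cos_multiples: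
  assumes "0 < m" "m < 2 * n"
  shows "(\<Sum>i<n. cos (pi * real m * real i / real n)) = (1 - (- 1) ^ m) / 2"
proof -
  define \<theta> where "\<theta> = pi * real m / real n"
  have n: "0 < n" using assms by simp
  have "0 < \<theta> / 2" "\<theta> / 2 < pi" using assms n by (auto simp: \<theta>_def divide_less_eq)
  then have pos: "0 < sin (\<theta> / 2)" by (rule sin_gt_zero)
  have tele: "2 * sin (\<theta> / 2) * (\<Sum>i<p. cos (\<theta> * real i)) = sin (\<theta> * real p - \<theta> / 2) + sin (\<theta> / 2)" for p
  proof (induction p)
    case (Suc p)
    have step: "2 * sin (\<theta> / 2) * cos (\<theta> * real p) = sin (\<theta> * real p + \<theta> / 2) - sin (\<theta> * real p - \<theta> / 2)"
      by (simp add: sin_add sin_diff)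
    have eq: "\<theta> * real (Suc p) - \<theta> / 2 = \<theta> * real p + \<theta> / 2"
      by (simp add: algebra_simps)
    show ?case unfolding eq sum.lessThan_Suc distrib_left using Suc.IH step by linarith
  qed simp
  have "\<theta> * real n = real m * pi" using n by (simp add: \<theta>_def)
  then have "2 * sin (\<theta> / 2) * (\<Sum>i<n. cos (\<theta> * real i)) = sin (\<theta> / 2) * (1 - (- 1) ^ m)"
    using tele[of n] by (simp add: sin_diff algebra_simps)
  then have "2 * (\<Sum>i<n. cos (\<theta> * real i)) = 1 - (- 1) ^ m"
    using pos by (simp add: mult.assoc mult.left_commute[of 2])
  then show ?thesis by (simp add: \<theta>_def field_simps)
qed

text \<open>Eigenvectors of the Dirichlet Laplacian on 1..N. The formula also covers the boundary
  points 0 and N + 1, where it vanishes, and is symmetric in \<open>k\<close> and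
  \<open>i\<close>.\<close>

definition sine_basis :: "nat \<Rightarrow> nat \<Rightarrow> nat \<Rightarrow> real" where
  "sine_basis N k i = sqrt (2 / real (N + 1)) * sin (pi * real k * real i / real (N + 1))"

text \<open>Eigenvalues of the tridiagonal matrix with 2 on the diagonal and -1 beside it.\<close>

definition laplace_eigenvalue :: "nat \<Rightarrow> nat \<Rightarrow> real" where
  "laplace_eigenvalue N k = 2 - 2 * cos (pi * real k / real (N + 1))"

lemma sine_basis_commute: "sine_basis N k i = sine_basis N i k"
  by (simp add: sine_basis_def mult_ac)

lemma sine_basis_0 [simp]: "sine_basis N k 0 = 0"
  by (simp add: sine_basis_def)

lemma sine_basis_end [simp]: "sine_basis N k (Suc N) = 0"
proof -
  have "pi * real k * real (Suc N) / real (N + 1) = real k * pi" by simp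
  then show ?thesis unfolding sine_basis_def by (simp only: sin_npi mult_zero_right)
qed

text \<open>A product of sines is a difference of cosines with frequencies \<open>k - l\<close> and
  \<open>k + l\<close>. These have equal parity, so for \<open>k \<noteq> l\<close> the two cosine
  sums agree; for \<open>k = l\<close> they are \<open>N + 1\<close> and 0.\<close>

lemma sine_basis_orthonormal:
  assumes "k \<in> {1..N}" "l \<in> {1..N}"
  shows "(\<Sum>i=1..N. sine_basis N k i * sine_basis N l i) = (if k = l then 1 else 0)"
  using assms
\<comment> \<open>Ordering the indices keeps the natural-number difference \<open>k - l\<close> from
  being truncated.\<close>
proof (induction k l rule: linorder_wlog)
  case (le l k)
  let ?n = "N + 1"
  let ?c = "\<lambda>m i. cos (pi * real m * real i / real ?n)"
  have "sine_basis N k i * sine_basis N l i = (?c (k - l) i - ?c (k + l) i) / real ?n" for i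
  proof -
    have "sine_basis N k i * sine_basis N l i
        = 2 / real ?n * (sin (pi * real k * real i / real ?n) * sin (pi * real l * real i / real ?n))"
    proof -
      have "sqrt (2 / real ?n) * sqrt (2 / real ?n) = 2 / real ?n" by simp
      moreover have "(r * s) * (r * t) = q * (s * t)" if "r * r = q" for r s t q :: real
        by (simp add: that[symmetric] mult_ac)
      ultimately show ?thesis unfolding sine_basis_def by blast
    qed
    also have "\<dots> = (?c (k - l) i - ?c (k + l) i) / real ?n"
    proof -
      have "pi * real k * real i / real ?n - pi * real l * real i / real ?n = pi * real (k - l) * real i / real ?n"
        using le by (simp add: of_nat_diff left_diff_distrib right_diff_distrib diff_divide_distrib)
      moreover have "pi * real k * real i / real ?n + pi * real l * real i / real ?n = pi * real (k + l) * real i / real ?n"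
        by (simp add: distrib_left distrib_right add_divide_distrib)
      moreover have "2 / q * ((u - v) / 2) = (u - v) / q" for q u v :: real
        by (cases "q = 0") (auto simp: field_simps)
      ultimately show ?thesis by (simp only: sin_times_sin)
    qed
    finally show ?thesis .
  qed
  then have "(\<Sum>i<?n. sine_basis N k i * sine_basis N l i)
      = ((\<Sum>i<?n. ?c (k - l) i) - (\<Sum>i<?n. ?c (k + l) i)) / real ?n"
    by (simp only: sum_divide_distrib sum_subtractf diff_divide_distrib)
  also have "\<dots> = (if k = l then 1 else 0)"
  proof (cases "k = l")
    case True
    then show ?thesis using le sum_cos_multiples[of "k + l" ?n] by simp
  next
    case False
    have "even (k + l) \<longleftrightarrow> even (k - l)" using le by auto
    then have "(- 1 :: real) ^ (k + l) = (- 1) ^ (k - l)" by (simp add: uminus_power_if)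
    moreover have m: "0 < k + l" "k + l < 2 * ?n" "0 < k - l" "k - l < 2 * ?n" using le False by auto
    ultimately show ?thesis
      unfolding sum_cos_multiples[OF m(1,2)] sum_cos_multiples[OF m(3,4)] using False by simp
  qed
  finally have "(\<Sum>i<?n. sine_basis N k i * sine_basis N l i) = (if k = l then 1 else 0)" .
  moreover have "(\<Sum>i<?n. sine_basis N k i * sine_basis N l i) = (\<Sum>i=1..N. sine_basis N k i * sine_basis N l i)"
    by (intro sum.mono_neutral_right) (auto simp: not_le)
  moreover have "(\<Sum>i=1..N. sine_basis N l i * sine_basis N k i) = (\<Sum>i=1..N. sine_basis N k i * sine_basis N l i)"
    by (intro sum.cong refl mult.commute)
  ultimately show ?case by (simp split: if_splits)
next
  case (sym k l)
  moreover have "(\<Sum>i=1..N. sine_basis N l i * sine_basis N k i) = (\<Sum>i=1..N. sine_basis N k i * sine_basis N l i)"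
    by (intro sum.cong refl mult.commute)
  ultimately show ?case by (simp split: if_splits)
qed

text \<open>The transform matrix is symmetric, so orthonormal rows give orthonormal columns.\<close>

lemma sine_basis_parseval:
  "(\<Sum>k=1..N. (\<Sum>i=1..N. sine_basis N k i * d i)\<^sup>2) = (\<Sum>i=1..N. (d i)\<^sup>2)"
proof -
  have orth: "(\<Sum>k=1..N. sine_basis N k i * sine_basis N k j) = (if i = j then 1 else 0)"
    if "i \<in> {1..N}" "j \<in> {1..N}" for i j
    using sine_basis_orthonormal[OF that] by (simp add: sine_basis_commute[of N i] sine_basis_commute[of N j])
  have "(\<Sum>k=1..N. (\<Sum>i=1..N. sine_basis N k i * d i)\<^sup>2)
      = (\<Sum>k=1..N. \<Sum>i=1..N. \<Sum>j=1..N. d i * d j * (sine_basis N k i * sine_basis N k j))"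
    by (simp only: power2_eq_square sum_product mult_ac)
  also have "\<dots> = (\<Sum>i=1..N. \<Sum>k=1..N. \<Sum>j=1..N. d i * d j * (sine_basis N k i * sine_basis N k j))"
    by (rule sum.swap)
  also have "\<dots> = (\<Sum>i=1..N. \<Sum>j=1..N. \<Sum>k=1..N. d i * d j * (sine_basis N k i * sine_basis N k j))"
    by (intro sum.cong refl sum.swap)
  also have "\<dots> = (\<Sum>i=1..N. \<Sum>j=1..N. if i = j then d i * d i else 0)"
    unfolding sum_distrib_left[symmetric]
    by (intro sum.cong refl) (simp only: orth, simp)
  also have "\<dots> = (\<Sum>i=1..N. (d i)\<^sup>2)"
    by (simp add: power2_eq_square)
  finally show ?thesis .
qed

lemma sum_by_parts:
  fixes u v :: "nat \<Rightarrow> real"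
  shows "(\<Sum>i\<le>p. (u i - u (Suc i)) * (v i - v (Suc i)))
    = (u 0 - u 1) * v 0 + (\<Sum>i=1..p. (2 * u i - u (i - 1) - u (Suc i)) * v i) - (u p - u (Suc p)) * v (Suc p)"
  by (induction p) (simp_all add: algebra_simps)

text \<open>Summation by parts turns the gradients into the discrete Laplacian of one factor; the
  boundary terms carry values at 0 and N + 1, where the basis vanishes.\<close>

lemma sine_basis_gradient_orthogonal:
  assumes "k \<in> {1..N}" "l \<in> {1..N}"
  shows "(\<Sum>i\<le>N. (sine_basis N k i - sine_basis N k (Suc i)) * (sine_basis N l i - sine_basis N l (Suc i)))
    = (if k = l then laplace_eigenvalue N k else 0)"
proof -
  have eigen: "2 * sine_basis N k i - sine_basis N k (i - 1) - sine_basis N k (Suc i)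
      = laplace_eigenvalue N k * sine_basis N k i" if "i \<in> {1..N}" for i
  proof -
    let ?x = "pi * real k * real i / real (N + 1)" and ?y = "pi * real k / real (N + 1)"
    have "pi * real k * real (i - 1) / real (N + 1) = ?x - ?y"
      "pi * real k * real (Suc i) / real (N + 1) = ?x + ?y"
      using that by (simp_all add: of_nat_diff diff_divide_distrib add_divide_distrib algebra_simps)
    then have "2 * sin ?x - sin (pi * real k * real (i - 1) / real (N + 1))
        - sin (pi * real k * real (Suc i) / real (N + 1)) = (2 - 2 * cos ?y) * sin ?x"
      by (simp only: sin_add sin_diff) (simp add: algebra_simps)
    moreover have "2 * (r * a) - r * b - r * c = L * (r * s)" if "2 * a - b - c = L * s" for r a b c L s :: real
      using arg_cong[OF that, of "\<lambda>x. r * x"] by (simp add: algebra_simps)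
    ultimately show ?thesis
      unfolding sine_basis_def laplace_eigenvalue_def by blast
  qed
  have "(\<Sum>i\<le>N. (sine_basis N k i - sine_basis N k (Suc i)) * (sine_basis N l i - sine_basis N l (Suc i)))
      = (\<Sum>i=1..N. laplace_eigenvalue N k * sine_basis N k i * sine_basis N l i)"
  proof -
    have "(\<Sum>i=1..N. (2 * sine_basis N k i - sine_basis N k (i - 1) - sine_basis N k (Suc i)) * sine_basis N l i)
        = (\<Sum>i=1..N. laplace_eigenvalue N k * sine_basis N k i * sine_basis N l i)"
      by (intro sum.cong refl) (simp only: eigen)
    then show ?thesis unfolding sum_by_parts by simp
  qed
  also have "\<dots> = laplace_eigenvalue N k * (if k = l then 1 else 0)"
    unfolding sine_basis_orthonormal[OF assms, symmetric] by (simp add: sum_distrib_left mult.assoc)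
  finally show ?thesis by simp
qed

text \<open>This moves the space difference from the random increments onto the basis, so that a
  mode becomes a combination of N + 1 uncorrelated variables.\<close>

lemma sine_basis_sum_differences:
  "(\<Sum>i=1..N. sine_basis N k i * (d i - d (i - 1))) = (\<Sum>i\<le>N. (sine_basis N k i - sine_basis N k (Suc i)) * d i)"
proof -
  have "(\<Sum>i\<le>p. (s i - s (Suc i)) * d i) = s 0 * d 0 + (\<Sum>i=1..p. s i * (d i - d (i - 1))) - s (Suc p) * d p"
    for p and s :: "nat \<Rightarrow> real"
    by (induction p) (simp_all add: algebra_simps)
  from this[of "sine_basis N k" N] show ?thesis by simp
qed

lemma laplace_eigenvalue_pos: "k \<in> {1..N} \<Longrightarrow> 0 < laplace_eigenvalue N k"
proof -
  assume k: "k \<in> {1..N}"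
  then have "0 < pi * real k / real (N + 1)" "pi * real k / real (N + 1) < pi"
    by (auto simp: divide_less_eq)
  then have "cos (pi * real k / real (N + 1)) < cos 0" by (intro cos_monotone_0_pi) auto
  then show ?thesis by (simp add: laplace_eigenvalue_def)
qed

lemma laplace_eigenvalue_le: "laplace_eigenvalue N k \<le> 4"
  using cos_ge_minus_one[of "pi * real k / real (N + 1)"] unfolding laplace_eigenvalue_def by linarith

text \<open>The trace of the squared tridiagonal matrix: 4N from the diagonal plus 2(N - 1) from its
  neighbours. It is computed from
  \<open>(2 - 2 * cos x)\<^sup>2 = 6 - 8 * cos x + 2 * cos (2 * x)\<close>.\<close>

lemma sum_laplace_eigenvalue_squares:
  assumes "1 \<le> N"
  shows "(\<Sum>k=1..N. (laplace_eigenvalue N k)\<^sup>2) = 6 * real N - 2"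
proof -
  let ?n = "N + 1"
  let ?c = "\<lambda>m i. cos (pi * real m * real i / real ?n)"
  \<comment> \<open>The final \<open>- 1\<close> removes the term at index 0, which the cosine
    formula includes.\<close>
  have sum: "(\<Sum>i=1..N. ?c m i) = (1 - (- 1) ^ m) / 2 - 1" if "0 < m" "m < 2 * ?n" for m
  proof -
    have "(\<Sum>i<?n. ?c m i) = ?c m 0 + (\<Sum>i=1..N. ?c m i)"
      by (subst sum.remove[of _ 0]) (auto intro!: sum.cong)
    moreover have "?c m 0 = 1" by simp
    ultimately show ?thesis unfolding sum_cos_multiples[OF that] by linarith
  qed
  have "(laplace_eigenvalue N k)\<^sup>2 = 6 - 8 * ?c 1 k + 2 * ?c 2 k" for k
  proof -
    have "?c 2 k = 2 * (cos (pi * real k / real ?n))\<^sup>2 - 1"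
      using cos_double_cos[of "pi * real k / real ?n"] by (simp add: mult_ac)
    then show ?thesis by (simp add: laplace_eigenvalue_def power2_diff power_mult_distrib)
  qed
  then have "(\<Sum>k=1..N. (laplace_eigenvalue N k)\<^sup>2) = 6 * real N - 8 * (\<Sum>k=1..N. ?c 1 k) + 2 * (\<Sum>k=1..N. ?c 2 k)"
    by (simp only: sum.distrib sum_subtractf sum_distrib_left) simp
  then show ?thesis using assms sum[of 1] sum[of 2] by simp
qed

section \<open>The quadratic variation\<close>

lemma sum_odd_squares: "(\<Sum>j<M. (2 * real j + 1)\<^sup>2) = real M * (4 * (real M)\<^sup>2 - 1) / 3"
  by (induction M) (simp_all add: field_simps power2_eq_square)

lemma sum_odd_fourth_le: "(\<Sum>j<M. (2 * real j + 1) ^ 4) \<le> 16 * real M ^ 5"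
proof -
  have "(\<Sum>j<M. (2 * real j + 1) ^ 4) \<le> (\<Sum>j<M. (2 * real M) ^ 4)"
    by (intro sum_mono power_mono) auto
  also have "\<dots> = 16 * real M ^ 5" by (simp add: power_mult_distrib power_Suc[of _ 4, symmetric])
  finally show ?thesis .
qed

text \<open>All bounds are proved for one fixed pair \<open>N\<close>, \<open>M\<close> with
  explicit constants; limits appear only in the final theorem.\<close>

locale wave_grid =
  fixes P :: "'a measure" and W :: "(real \<times> real \<Rightarrow> real) \<Rightarrow> 'a \<Rightarrow> real"
    and \<alpha> :: real and N M :: nat
  assumes white_noise: "space_time_white_noise P W"
    and N: "1 \<le> N" and M: "1 \<le> M" and mesh: "2 * real M powr (1 - \<alpha>) < 1 / real N"
begin

sublocale prob_space P
  using white_noise by (simp add: space_time_white_noise_def)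

definition \<delta> :: real where "\<delta> = real M powr (- \<alpha>)"

text \<open>A variance, not a standard deviation: that of a time increment, the step of the clock
  \<open>t\<^sup>2 / 4\<close> between consecutive grid times, with
  \<open>(j + 1)\<^sup>2 - j\<^sup>2 = 2 * j + 1\<close>.\<close>

definition \<sigma> :: "nat \<Rightarrow> real" where "\<sigma> j = \<delta>\<^sup>2 / 4 * (2 * real j + 1)"

definition time_increment :: "nat \<Rightarrow> nat \<Rightarrow> 'a \<Rightarrow> real" where
  "time_increment i j \<omega> = mild_solution W (grid_t \<alpha> M (j + 1)) (grid_x N i) \<omega>
     - mild_solution W (grid_t \<alpha> M j) (grid_x N i) \<omega>"

lemma delta_pos: "0 < \<delta>" using M by (simp add: \<delta>_def)

lemma sigma_pos: "0 < \<sigma> j" using delta_pos by (simp add: \<sigma>_def)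

lemma grid_t_eq: "grid_t \<alpha> M j = real j * \<delta>" by (simp add: grid_t_def \<delta>_def)

lemma jointly_gaussian: "jointly_centred_gaussian P L2_time_space W"
  using white_noise by (simp add: space_time_white_noise_def)

lemma mild_solution_span:
  "0 \<le> t \<Longrightarrow> mild_solution W t x \<in> gaussian_span L2_time_space W"
  using gaussian_span_base[OF wave_kernel_L2, of t W x]
  by (simp add: mild_solution_kernel[abs_def])

lemma time_increment_span: "time_increment i j \<in> gaussian_span L2_time_space W"
  unfolding time_increment_def[abs_def] grid_t_eq
  using delta_pos by (intro gaussian_span_diff mild_solution_span) auto

text \<open>By the mesh condition the backward cones of distinct space points do not meet before
  time \<open>grid_t \<alpha> M M\<close>.\<close>

lemma mild_solution_grid_covariance:
  assumes "j \<le> M" "j' \<le> M"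
  shows "expectation (\<lambda>\<omega>. mild_solution W (grid_t \<alpha> M j) (grid_x N i) \<omega>
      * mild_solution W (grid_t \<alpha> M j') (grid_x N i') \<omega>)
    = (if i = i' then \<delta>\<^sup>2 / 4 * (real (min j j'))\<^sup>2 else 0)"
proof -
  have nn: "0 \<le> grid_t \<alpha> M j" "0 \<le> grid_t \<alpha> M j'" using delta_pos by (auto simp: grid_t_eq)
  show ?thesis
  proof (cases "i = i'")
    case True
    have "min (grid_t \<alpha> M j) (grid_t \<alpha> M j') = real (min j j') * \<delta>"
      using delta_pos by (auto simp: grid_t_eq min_def)
    then show ?thesis
      using True mild_solution_covariance(1)[OF white_noise nn, of "grid_x N i'"]
      by (simp add: power_mult_distrib)
  next
    case False
    have "real j * \<delta> \<le> real M * \<delta>" "real j' * \<delta> \<le> real M * \<delta>"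
      using assms delta_pos by (auto intro!: mult_right_mono)
    moreover have "real M * \<delta> = real M powr (1 - \<alpha>)"
      using M by (simp add: \<delta>_def powr_mult_base)
    moreover have "1 / real N \<le> \<bar>grid_x N i - grid_x N i'\<bar>"
    proof -
      have "1 \<le> \<bar>real i - real i'\<bar>" using False by linarith
      then show ?thesis
        using N by (simp add: grid_x_def divide_right_mono flip: diff_divide_distrib)
    qed
    ultimately have "grid_t \<alpha> M j + grid_t \<alpha> M j' \<le> \<bar>grid_x N i - grid_x N i'\<bar>"
      using mesh by (simp add: grid_t_eq)
    then show ?thesis
      using False mild_solution_covariance(2)[OF white_noise nn] by simp
  qed
qed

text \<open>Taking differences of \<open>(min j j')\<^sup>2\<close> in both indices gives 0 off the
  diagonal and \<open>2 * j + 1\<close> on it.\<close>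

lemma time_increment_covariance:
  assumes "j < M" "j' < M"
  shows "expectation (\<lambda>\<omega>. time_increment i j \<omega> * time_increment i' j' \<omega>)
    = (if i = i' \<and> j = j' then \<sigma> j else 0)"
proof -
  define U where "U i j = mild_solution W (grid_t \<alpha> M j) (grid_x N i)" for i j
  have int: "integrable P (\<lambda>\<omega>. U i j \<omega> * U i' j' \<omega>)" for i j i' j'
    unfolding U_def grid_t_eq using delta_pos
    by (intro integrable_gaussian_span_mult[OF jointly_gaussian] mild_solution_span) auto
  have cov: "expectation (\<lambda>\<omega>. U i j \<omega> * U i' j' \<omega>) = (if i = i' then \<delta>\<^sup>2 / 4 * (real (min j j'))\<^sup>2 else 0)"
    if "j \<le> M" "j' \<le> M" for i i' j j'
    unfolding U_def using that by (rule mild_solution_grid_covariance)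
  have "time_increment i j \<omega> * time_increment i' j' \<omega>
      = U i (j + 1) \<omega> * U i' (j' + 1) \<omega> - U i (j + 1) \<omega> * U i' j' \<omega>
        - (U i j \<omega> * U i' (j' + 1) \<omega> - U i j \<omega> * U i' j' \<omega>)" for \<omega>
    by (simp add: time_increment_def U_def algebra_simps)
  then have "expectation (\<lambda>\<omega>. time_increment i j \<omega> * time_increment i' j' \<omega>)
      = expectation (\<lambda>\<omega>. U i (j + 1) \<omega> * U i' (j' + 1) \<omega>) - expectation (\<lambda>\<omega>. U i (j + 1) \<omega> * U i' j' \<omega>)
        - (expectation (\<lambda>\<omega>. U i j \<omega> * U i' (j' + 1) \<omega>) - expectation (\<lambda>\<omega>. U i j \<omega> * U i' j' \<omega>))"
    by (simp only: Bochner_Integration.integral_diff Bochner_Integration.integrable_diff int)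
  also have "\<dots> = (if i = i' \<and> j = j' then \<sigma> j else 0)"
  proof (cases "i = i'")
    case True
    consider "j < j'" | "j = j'" | "j' < j" by linarith
    then show ?thesis
      using True assms by cases (simp_all add: cov min_absorb1 min_absorb2 Suc_le_eq \<sigma>_def power2_eq_square algebra_simps)
  next
    case False
    then show ?thesis using assms by (simp add: cov)
  qed
  finally show ?thesis .
qed

text \<open>The discrete sine transform in space of the rectangle increments. The basis starts at
  index 1 and rectangles at 0, so \<open>i\<close> is paired with rectangle
  \<open>i - 1\<close>.\<close>

definition sine_mode :: "nat \<Rightarrow> nat \<Rightarrow> 'a \<Rightarrow> real" where
  "sine_mode k j \<omega> = (\<Sum>i=1..N. sine_basis N k i * (time_increment i j \<omega> - time_increment (i - 1) j \<omega>))"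

lemma sine_mode_eq:
  "sine_mode k j \<omega> = (\<Sum>i\<le>N. (sine_basis N k i - sine_basis N k (Suc i)) * time_increment i j \<omega>)"
  unfolding sine_mode_def by (rule sine_basis_sum_differences)

lemma sine_mode_span: "sine_mode k j \<in> gaussian_span L2_time_space W"
  unfolding sine_mode_eq[abs_def]
  by (intro gaussian_span_sum gaussian_span_scale time_increment_span) simp

text \<open>Time increments are uncorrelated with a variance independent of the space index, so the
  covariance is the scalar product of the basis gradients times \<open>\<sigma> j\<close>.\<close>

lemma sine_mode_covariance:
  assumes "k \<in> {1..N}" "l \<in> {1..N}" "j < M" "j' < M"
  shows "expectation (\<lambda>\<omega>. sine_mode k j \<omega> * sine_mode l j' \<omega>)
    = (if k = l \<and> j = j' then laplace_eigenvalue N k * \<sigma> j else 0)"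
proof -
  let ?g = "\<lambda>k i. sine_basis N k i - sine_basis N k (Suc i)"
  have "expectation (\<lambda>\<omega>. sine_mode k j \<omega> * sine_mode l j' \<omega>)
      = (\<Sum>i\<le>N. \<Sum>i'\<le>N. ?g k i * ?g l i' * expectation (\<lambda>\<omega>. time_increment i j \<omega> * time_increment i' j' \<omega>))"
    unfolding sine_mode_eq
    by (intro expectation_sum_mult_sum integrable_gaussian_span_mult[OF jointly_gaussian] time_increment_span)
  also have "\<dots> = (\<Sum>i\<le>N. \<Sum>i'\<le>N. if i = i' then ?g k i * ?g l i * (if j = j' then \<sigma> j else 0) else 0)"
    using assms by (intro sum.cong refl) (auto simp: time_increment_covariance)
  also have "\<dots> = (\<Sum>i\<le>N. ?g k i * ?g l i) * (if j = j' then \<sigma> j else 0)"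
    by (simp add: sum_distrib_right)
  finally show ?thesis
    unfolding sine_basis_gradient_orthogonal[OF assms(1,2)] by simp
qed

section \<open>Normalised modes and chaos weights\<close>

definition modes :: "(nat \<times> nat) set" where "modes = {1..N} \<times> {..<M}"

definition normal_mode :: "nat \<times> nat \<Rightarrow> 'a \<Rightarrow> real" where
  "normal_mode = (\<lambda>(k, j) \<omega>. sine_mode k j \<omega> / sqrt (laplace_eigenvalue N k * \<sigma> j))"

lemma mode_variance_pos: "k \<in> {1..N} \<Longrightarrow> 0 < laplace_eigenvalue N k * \<sigma> j"
  by (intro mult_pos_pos laplace_eigenvalue_pos sigma_pos)

sublocale iid_std_normal P normal_mode modes
proof (rule orthonormal_gaussian_span_iid[OF jointly_gaussian])
  show "finite modes" by (simp add: modes_def)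
  fix p assume p: "p \<in> modes"
  obtain k j where kj: "p = (k, j)" by fastforce
  show "normal_mode p \<in> gaussian_span L2_time_space W"
    using gaussian_span_scale[OF sine_mode_span, of "1 / sqrt (laplace_eigenvalue N k * \<sigma> j)" k j]
    by (simp add: normal_mode_def kj)
  fix q assume q: "q \<in> modes"
  obtain l j' where lj: "q = (l, j')" by fastforce
  have "normal_mode p \<omega> * normal_mode q \<omega>
      = sine_mode k j \<omega> * sine_mode l j' \<omega> / (sqrt (laplace_eigenvalue N k * \<sigma> j) * sqrt (laplace_eigenvalue N l * \<sigma> j'))" for \<omega>
    by (simp add: normal_mode_def kj lj)
  then have "expectation (\<lambda>\<omega>. normal_mode p \<omega> * normal_mode q \<omega>)
      = (if k = l \<and> j = j' then laplace_eigenvalue N k * \<sigma> j else 0)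
        / (sqrt (laplace_eigenvalue N k * \<sigma> j) * sqrt (laplace_eigenvalue N l * \<sigma> j'))"
    using p q by (simp add: sine_mode_covariance modes_def kj lj)
  then show "expectation (\<lambda>\<omega>. normal_mode p \<omega> * normal_mode q \<omega>) = (if p = q then 1 else 0)"
    using p mode_variance_pos[of k j] unfolding kj lj modes_def by auto
qed

definition weight :: "nat \<times> nat \<Rightarrow> real" where
  "weight = (\<lambda>(k, j). laplace_eigenvalue N k * \<sigma> j / (real N * real M))"

lemma sum_modes: "(\<Sum>p\<in>modes. f (fst p) * g (snd p)) = (\<Sum>k=1..N. f k) * (\<Sum>j<M. g j :: real)"
  unfolding modes_def sum_product by (subst sum.cartesian_product) (auto intro!: sum.cong)

lemma sum_weight_squares:
  "(\<Sum>p\<in>modes. (weight p)\<^sup>2)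
    = (6 * real N - 2) * (\<delta> ^ 4 / 16 * (real M * (4 * (real M)\<^sup>2 - 1) / 3)) / (real N * real M)\<^sup>2"
proof -
  have "(\<Sum>p\<in>modes. (weight p)\<^sup>2)
      = (\<Sum>p\<in>modes. (laplace_eigenvalue N (fst p))\<^sup>2 * (\<sigma> (snd p))\<^sup>2) / (real N * real M)\<^sup>2"
    by (simp add: weight_def case_prod_beta power_mult_distrib power_divide sum_divide_distrib)
  also have "(\<Sum>p\<in>modes. (laplace_eigenvalue N (fst p))\<^sup>2 * (\<sigma> (snd p))\<^sup>2)
      = (6 * real N - 2) * (\<Sum>j<M. (\<sigma> j)\<^sup>2)"
    unfolding sum_laplace_eigenvalue_squares[OF N, symmetric] by (rule sum_modes)
  also have "(\<Sum>j<M. (\<sigma> j)\<^sup>2) = \<delta> ^ 4 / 16 * (\<Sum>j<M. (2 * real j + 1)\<^sup>2)"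
    by (simp add: \<sigma>_def power_mult_distrib power_divide sum_distrib_left flip: power_mult)
  finally show ?thesis unfolding sum_odd_squares .
qed

text \<open>\<open>6 * N - 2 \<ge> 4 * N\<close> and
  \<open>4 * M\<^sup>2 - 1 \<ge> 3 * M\<^sup>2\<close> reduce the exact sum to a monomial of the
  same order.\<close>

lemma sum_weight_squares_ge:
  "real N * real M ^ 3 * \<delta> ^ 4 / (4 * (real N * real M)\<^sup>2) \<le> (\<Sum>p\<in>modes. (weight p)\<^sup>2)"
proof -
  have "1 \<le> (real M)\<^sup>2" using M by simp
  then have "real M * (3 * (real M)\<^sup>2) \<le> real M * (4 * (real M)\<^sup>2 - 1)"
    by (intro mult_left_mono) auto
  then have le: "\<delta> ^ 4 / 16 * (real M ^ 3) \<le> \<delta> ^ 4 / 16 * (real M * (4 * (real M)\<^sup>2 - 1) / 3)"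
    by (intro mult_left_mono) (auto simp: power3_eq_cube power2_eq_square)
  have "4 * real N \<le> 6 * real N - 2" using N by simp
  from mult_mono[OF this le] have "4 * real N * (\<delta> ^ 4 / 16 * (real M ^ 3))
      \<le> (6 * real N - 2) * (\<delta> ^ 4 / 16 * (real M * (4 * (real M)\<^sup>2 - 1) / 3))"
    using N by simp
  then have "4 * real N * (\<delta> ^ 4 / 16 * (real M ^ 3)) / (real N * real M)\<^sup>2 \<le> (\<Sum>p\<in>modes. (weight p)\<^sup>2)"
    unfolding sum_weight_squares by (intro divide_right_mono) auto
  then show ?thesis by (simp add: field_simps)
qed

text \<open>Eigenvalues are at most 4 and the odd numbers \<open>2 * j + 1\<close> at most
  \<open>2 * M\<close>; these crude bounds already have the right order.\<close>

lemma sum_weight_fourth_le: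
  "(\<Sum>p\<in>modes. weight p ^ 4) \<le> 16 * real N * real M ^ 5 * \<delta> ^ 8 / (real N * real M) ^ 4"
proof -
  have "(\<Sum>p\<in>modes. weight p ^ 4)
      = (\<Sum>p\<in>modes. laplace_eigenvalue N (fst p) ^ 4 * \<sigma> (snd p) ^ 4) / (real N * real M) ^ 4"
    by (simp add: weight_def case_prod_beta power_mult_distrib power_divide sum_divide_distrib)
  also have "(\<Sum>p\<in>modes. laplace_eigenvalue N (fst p) ^ 4 * \<sigma> (snd p) ^ 4)
      = (\<Sum>k=1..N. laplace_eigenvalue N k ^ 4) * (\<Sum>j<M. \<sigma> j ^ 4)"
    by (rule sum_modes)
  also have "\<dots> \<le> (256 * real N) * (\<delta> ^ 8 / 256 * (16 * real M ^ 5))"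
  proof (rule mult_mono)
    have "(\<Sum>k=1..N. laplace_eigenvalue N k ^ 4) \<le> (\<Sum>k=1..N. 4 ^ 4)"
      by (intro sum_mono power_mono laplace_eigenvalue_le less_imp_le[OF laplace_eigenvalue_pos])
    then show "(\<Sum>k=1..N. laplace_eigenvalue N k ^ 4) \<le> 256 * real N" by simp
    have "(\<Sum>j<M. \<sigma> j ^ 4) = \<delta> ^ 8 / 256 * (\<Sum>j<M. (2 * real j + 1) ^ 4)"
      by (simp add: \<sigma>_def power_mult_distrib power_divide sum_distrib_left flip: power_mult)
    also have "\<dots> \<le> \<delta> ^ 8 / 256 * (16 * real M ^ 5)"
      by (intro mult_left_mono sum_odd_fourth_le) auto
    finally show "(\<Sum>j<M. \<sigma> j ^ 4) \<le> \<delta> ^ 8 / 256 * (16 * real M ^ 5)" .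
  qed (auto intro!: sum_nonneg)
  finally show ?thesis by (simp add: divide_right_mono mult_ac)
qed

text \<open>Parseval in space, at each time index separately, replaces the squared rectangle
  increments by squared modes, both pointwise and in mean.\<close>

lemma quad_var_chaos: "quad_var P (mild_solution W) \<alpha> N M = chaos weight"
proof
  fix \<omega>
  let ?D = "\<lambda>i j \<omega>. rect_increment (mild_solution W) \<alpha> N M i j \<omega>"
  let ?v = "\<lambda>k j. laplace_eigenvalue N k * \<sigma> j"
  have D: "?D i j \<omega> = time_increment (Suc i) j \<omega> - time_increment i j \<omega>" for i j \<omega>
    by (simp add: rect_increment_def time_increment_def)
  have parseval: "(\<Sum>i<N. (?D i j \<omega>)\<^sup>2) = (\<Sum>k=1..N. (sine_mode k j \<omega>)\<^sup>2)" for j \<omega>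
  proof -
    have "(\<Sum>i<N. (?D i j \<omega>)\<^sup>2) = (\<Sum>i=1..N. (time_increment i j \<omega> - time_increment (i - 1) j \<omega>)\<^sup>2)"
      unfolding D by (simp add: sum.atLeast1_atMost_eq)
    then show ?thesis unfolding sine_mode_def sine_basis_parseval by simp
  qed
  have intD: "integrable P (\<lambda>\<omega>. (?D i j \<omega>)\<^sup>2)" for i j
    unfolding D power2_eq_square
    by (intro integrable_gaussian_span_mult[OF jointly_gaussian] gaussian_span_diff time_increment_span)
  have ints: "integrable P (\<lambda>\<omega>. (sine_mode k j \<omega>)\<^sup>2)" for k j
    unfolding power2_eq_square
    by (intro integrable_gaussian_span_mult[OF jointly_gaussian] sine_mode_span)
  have mean: "(\<Sum>i<N. expectation (\<lambda>\<omega>. (?D i j \<omega>)\<^sup>2)) = (\<Sum>k=1..N. ?v k j)" if "j < M" for j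
  proof -
    have "(\<Sum>i<N. expectation (\<lambda>\<omega>. (?D i j \<omega>)\<^sup>2)) = expectation (\<lambda>\<omega>. \<Sum>i<N. (?D i j \<omega>)\<^sup>2)"
      by (rule Bochner_Integration.integral_sum[symmetric]) (rule intD)
    also have "\<dots> = (\<Sum>k=1..N. expectation (\<lambda>\<omega>. (sine_mode k j \<omega>)\<^sup>2))"
      unfolding parseval by (rule Bochner_Integration.integral_sum) (rule ints)
    also have "\<dots> = (\<Sum>k=1..N. ?v k j)"
      using that by (intro sum.cong refl) (simp add: power2_eq_square sine_mode_covariance)
    finally show ?thesis .
  qed
  have mode: "(sine_mode k j \<omega>)\<^sup>2 = ?v k j * (normal_mode (k, j) \<omega>)\<^sup>2" if "k \<in> {1..N}" for k j
  proof -
    have "(normal_mode (k, j) \<omega>)\<^sup>2 = (sine_mode k j \<omega>)\<^sup>2 / ?v k j"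
      using mode_variance_pos[OF that, of j] by (simp add: normal_mode_def power_divide)
    then show ?thesis
      using mode_variance_pos[OF that, of j] by (metis less_irrefl nonzero_mult_div_cancel_left times_divide_eq_right)
  qed
  have "quad_var P (mild_solution W) \<alpha> N M \<omega>
      = 1 / (real N * real M) * (\<Sum>j<M. \<Sum>i<N. (?D i j \<omega>)\<^sup>2 - expectation (\<lambda>\<omega>. (?D i j \<omega>)\<^sup>2))"
    unfolding quad_var_def by (subst sum.swap) (rule refl)
  also have "(\<Sum>j<M. \<Sum>i<N. (?D i j \<omega>)\<^sup>2 - expectation (\<lambda>\<omega>. (?D i j \<omega>)\<^sup>2))
      = (\<Sum>j<M. \<Sum>k=1..N. ?v k j * ((normal_mode (k, j) \<omega>)\<^sup>2 - 1))"
  proof (rule sum.cong)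
    fix j assume "j \<in> {..<M}"
    then have j: "j < M" by simp
    have "(\<Sum>i<N. (?D i j \<omega>)\<^sup>2 - expectation (\<lambda>\<omega>. (?D i j \<omega>)\<^sup>2))
        = (\<Sum>k=1..N. (sine_mode k j \<omega>)\<^sup>2) - (\<Sum>k=1..N. ?v k j)"
      unfolding sum_subtractf parseval mean[OF j] ..
    also have "\<dots> = (\<Sum>k=1..N. ?v k j * ((normal_mode (k, j) \<omega>)\<^sup>2 - 1))"
      unfolding sum_subtractf[symmetric] by (intro sum.cong refl) (simp add: mode right_diff_distrib)
    finally show "(\<Sum>i<N. (?D i j \<omega>)\<^sup>2 - expectation (\<lambda>\<omega>. (?D i j \<omega>)\<^sup>2))
        = (\<Sum>k=1..N. ?v k j * ((normal_mode (k, j) \<omega>)\<^sup>2 - 1))" .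
  qed simp
  also have "\<dots> = (\<Sum>k=1..N. \<Sum>j<M. ?v k j * ((normal_mode (k, j) \<omega>)\<^sup>2 - 1))"
    by (rule sum.swap)
  also have "\<dots> = (\<Sum>p\<in>modes. ?v (fst p) (snd p) * ((normal_mode p \<omega>)\<^sup>2 - 1))"
    unfolding modes_def sum.cartesian_product by (simp add: case_prod_beta)
  finally show "quad_var P (mild_solution W) \<alpha> N M \<omega> = chaos weight \<omega>"
    by (simp add: chaos_def weight_def case_prod_beta sum_distrib_left)
qed

lemma variance_quad_var:
  "variance (quad_var P (mild_solution W) \<alpha> N M) = 2 * (\<Sum>p\<in>modes. (weight p)\<^sup>2)"
  unfolding quad_var_chaos by (simp add: expectation_chaos chaos_second_moment)

text \<open>The squared scale is \<open>N / (\<delta> ^ 4 * M)\<close>, which cancels the mesh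
  exactly. A prefactor \<open>sqrt (8 * N)\<close> in place of \<open>sqrt N\<close> would multiply
  this variance by 8.\<close>

lemma variance_scaled_quad_var:
  "variance (scaled_quad_var P (mild_solution W) \<alpha> N M)
    = (1 - 1 / (4 * (real M)\<^sup>2)) * (1 - 1 / (3 * real N))"
proof -
  let ?s = "sqrt (real N) * real M powr (2 * \<alpha> - 1 / 2)"
  have "scaled_quad_var P (mild_solution W) \<alpha> N M = (\<lambda>\<omega>. ?s * chaos weight \<omega>)"
    by (simp add: scaled_quad_var_def[abs_def] quad_var_chaos)
  then have "variance (scaled_quad_var P (mild_solution W) \<alpha> N M) = ?s\<^sup>2 * (2 * (\<Sum>p\<in>modes. (weight p)\<^sup>2))"
    by (simp add: expectation_chaos power_mult_distrib chaos_second_moment)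
  also have "?s\<^sup>2 = real N * real M powr (4 * \<alpha> - 1)"
    using M by (simp add: power_mult_distrib powr_power algebra_simps)
  also have "real M powr (4 * \<alpha> - 1) = 1 / (\<delta> ^ 4 * real M)"
    using M by (simp add: \<delta>_def powr_power powr_minus powr_diff field_simps)
  finally have "variance (scaled_quad_var P (mild_solution W) \<alpha> N M)
      = real N * (1 / (\<delta> ^ 4 * real M)) * (2 * (\<Sum>p\<in>modes. (weight p)\<^sup>2))" .
  also have "\<dots> = (1 - 1 / (4 * (real M)\<^sup>2)) * (1 - 1 / (3 * real N))"
  proof -
    have nz: "\<delta> \<noteq> 0" "real M \<noteq> 0" "real N \<noteq> 0" using delta_pos M N by auto
    have "x * (1 / (d * m)) * (2 * ((6 * x - 2) * (d / 16 * (m * (4 * m\<^sup>2 - 1) / 3)) / (x * m)\<^sup>2))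
        = (1 - 1 / (4 * m\<^sup>2)) * (1 - 1 / (3 * x))" if "d \<noteq> 0" "m \<noteq> 0" "x \<noteq> 0" for d m x :: real
      using that by (simp add: divide_simps power2_eq_square) (simp add: algebra_simps)
    then show ?thesis unfolding sum_weight_squares using nz by simp
  qed
  finally show ?thesis .
qed

text \<open>Dividing the weights by the exact standard deviation gives unit variance, as the Stein
  bound demands. The constant 512 is 8 from the Stein bound times 64, which is 16 from the fourth
  powers divided by the square of the 1/2 in the variance bound.\<close>

lemma normalised_weight:
  defines "v \<equiv> 2 * (\<Sum>p\<in>modes. (weight p)\<^sup>2)"
  shows "normalised_quad_var P (mild_solution W) \<alpha> N M = chaos (\<lambda>p. weight p / sqrt v)"
    and "2 * (\<Sum>p\<in>modes. (weight p / sqrt v)\<^sup>2) = 1"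
    and "3 * sqrt (8 * (\<Sum>p\<in>modes. (weight p / sqrt v) ^ 4)) \<le> 3 * sqrt 512 / sqrt (real N * real M)"
proof -
  \<comment> \<open>Twice the lower bound for the sum of squared weights, hence a lower bound for
    the variance \<open>v\<close>.\<close>
  let ?w = "real N * real M ^ 3 * \<delta> ^ 4 / (2 * (real N * real M)\<^sup>2)"
  have w: "0 < ?w" using N M delta_pos by simp
  have v: "?w \<le> v" using sum_weight_squares_ge by (simp add: v_def)
  then have v0: "0 < v" using w by linarith
  show "normalised_quad_var P (mild_solution W) \<alpha> N M = chaos (\<lambda>p. weight p / sqrt v)"
    unfolding normalised_quad_var_def[abs_def] variance_quad_var v_def[symmetric]
    by (simp add: fun_eq_iff quad_var_chaos chaos_def sum_divide_distrib)
  show "2 * (\<Sum>p\<in>modes. (weight p / sqrt v)\<^sup>2) = 1"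
    using v0 by (simp add: power_divide v_def flip: sum_divide_distrib)
  have "sqrt v ^ 4 = v\<^sup>2"
    using v0 by (simp add: power4_eq_xxxx power2_eq_square)
  then have "(\<Sum>p\<in>modes. (weight p / sqrt v) ^ 4) = (\<Sum>p\<in>modes. weight p ^ 4) / v\<^sup>2"
    by (simp add: power_divide sum_divide_distrib)
  also have "\<dots> \<le> (16 * real N * real M ^ 5 * \<delta> ^ 8 / (real N * real M) ^ 4) / ?w\<^sup>2"
    by (rule frac_le[OF _ sum_weight_fourth_le zero_less_power[OF w] power_mono[OF v less_imp_le[OF w]]]) simp
  also have "\<dots> = 64 / (real N * real M)"
  proof -
    have "(16 * x * m ^ 5 * d ^ 8 / (x * m) ^ 4) / (x * m ^ 3 * d ^ 4 / (2 * (x * m)\<^sup>2))\<^sup>2 = 64 / (x * m)"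
      if "d \<noteq> 0" "m \<noteq> 0" "x \<noteq> 0" for d m x :: real
      using that by (simp add: power_divide power_mult_distrib flip: power_mult)
        (simp add: divide_simps power2_eq_square power4_eq_xxxx power3_eq_cube eval_nat_numeral)
    then show ?thesis using N M delta_pos by simp
  qed
  finally have "sqrt (8 * (\<Sum>p\<in>modes. (weight p / sqrt v) ^ 4)) \<le> sqrt (512 / (real N * real M))"
    by (intro real_sqrt_le_mono) simp
  then show "3 * sqrt (8 * (\<Sum>p\<in>modes. (weight p / sqrt v) ^ 4)) \<le> 3 * sqrt 512 / sqrt (real N * real M)"
    by (simp add: real_sqrt_divide)
qed

lemma distance_bound:
  assumes "d \<in> {kolmogorov_dist, wasserstein_dist, total_variation_dist}"
  shows "d (distr P borel (normalised_quad_var P (mild_solution W) \<alpha> N M)) std_normal_distribution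
    \<le> ennreal (3 * sqrt 512 / sqrt (real N * real M))"
proof -
  let ?a = "\<lambda>p. weight p / sqrt (2 * (\<Sum>p\<in>modes. (weight p)\<^sup>2))"
  have "d (distr P borel (chaos ?a)) std_normal_distribution \<le> ennreal (3 * sqrt (8 * (\<Sum>p\<in>modes. ?a p ^ 4)))"
    using assms chaos_wasserstein[OF normalised_weight(2)] chaos_total_variation[OF normalised_weight(2)]
      order.trans[OF kolmogorov_le_total_variation chaos_total_variation[OF normalised_weight(2)]]
    by blast
  also have "\<dots> \<le> ennreal (3 * sqrt 512 / sqrt (real N * real M))"
    by (intro ennreal_leI normalised_weight(3))
  finally show ?thesis unfolding normalised_weight(1) .
qed

end

theorem theorem7:
  fixes P :: "'a measure"
    and W :: "(real \<times> real \<Rightarrow> real) \<Rightarrow> 'a \<Rightarrow> real"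
    and \<alpha> :: real
    and M :: "nat \<Rightarrow> nat"
  assumes "space_time_white_noise P W"
    and "\<And>N. N \<ge> 1 \<Longrightarrow> M N \<ge> 1"
    and "filterlim M at_top sequentially"
    and "\<And>N. N \<ge> 1 \<Longrightarrow> 2 * real (M N) powr (1 - \<alpha>) < 1 / real N"
  shows "(\<lambda>N. prob_space.variance P (scaled_quad_var P (mild_solution W) \<alpha> N (M N)))
           \<longlonglongrightarrow> 1
       \<and> (\<forall>d\<in>{kolmogorov_dist, wasserstein_dist, total_variation_dist}.
            \<exists>C::real. \<forall>\<^sub>F N in sequentially.
              d (distr P borel (normalised_quad_var P (mild_solution W) \<alpha> N (M N)))
                std_normal_distribution
              \<le> ennreal (C / sqrt (real N * real (M N))))"
proof
  have grid: "wave_grid P W \<alpha> N (M N)" if "1 \<le> N" for N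
    using assms that by unfold_locales auto
  have "(\<lambda>N. (1 - 1 / (4 * (real (M N))\<^sup>2)) * (1 - 1 / (3 * real N))) \<longlonglongrightarrow> (1 - 0) * (1 - 0)"
  proof (intro tendsto_intros)
    have inv: "(\<lambda>n. 1 / (4 * (real n)\<^sup>2)) \<longlonglongrightarrow> 0" "(\<lambda>n. 1 / (3 * real n)) \<longlonglongrightarrow> 0"
      using tendsto_power[OF lim_const_over_n[of "1 / 2 :: real"], of 2] lim_const_over_n[of "1 / 3 :: real"]
      by (simp_all add: power_mult_distrib power_divide)
    show "(\<lambda>N. 1 / (3 * real N)) \<longlonglongrightarrow> 0" by (rule inv)
    show "(\<lambda>N. 1 / (4 * (real (M N))\<^sup>2)) \<longlonglongrightarrow> 0"
      by (rule filterlim_compose[OF inv(1) assms(3)])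
  qed
  moreover have "\<forall>\<^sub>F N in sequentially. (1 - 1 / (4 * (real (M N))\<^sup>2)) * (1 - 1 / (3 * real N))
      = prob_space.variance P (scaled_quad_var P (mild_solution W) \<alpha> N (M N))"
    using eventually_ge_at_top[of 1]
    by eventually_elim (simp add: wave_grid.variance_scaled_quad_var[OF grid])
  ultimately show "(\<lambda>N. prob_space.variance P (scaled_quad_var P (mild_solution W) \<alpha> N (M N))) \<longlonglongrightarrow> 1"
    by (simp add: Lim_transform_eventually)
  show "\<forall>d\<in>{kolmogorov_dist, wasserstein_dist, total_variation_dist}.
      \<exists>C::real. \<forall>\<^sub>F N in sequentially.
        d (distr P borel (normalised_quad_var P (mild_solution W) \<alpha> N (M N))) std_normal_distribution
        \<le> ennreal (C / sqrt (real N * real (M N)))"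
  \<comment> \<open>The witness is the constant \<open>3 * sqrt 512\<close> of the fixed-grid bound,
    the same for all three distances and valid from \<open>N = 1\<close> on.\<close>
  proof (intro ballI exI)
    fix d assume d: "d \<in> {kolmogorov_dist, wasserstein_dist, total_variation_dist}"
    show "\<forall>\<^sub>F N in sequentially.
        d (distr P borel (normalised_quad_var P (mild_solution W) \<alpha> N (M N))) std_normal_distribution
        \<le> ennreal (3 * sqrt 512 / sqrt (real N * real (M N)))"
      using eventually_ge_at_top[of 1]
      by eventually_elim (rule wave_grid.distance_bound[OF grid d])
  qed
qed

end
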